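(* The Okounkov--Olshanski and Knutson--Tao formulas for $f^{\lambda/\mu}$ are term-by-term equivalent. That is: let $\lambda$ be a partition with $d=\ell(\lambda)$ parts, let $\mu$ be a partition with $[\mu]\subseteq[\lambda]$, and fix a $d\times b$ box containing $\lambda$ (so $b\ge\lambda_1$). Then there is a bijection $T\mapsto P$ from $\mathcal{OOT}(\lambda/\mu)$ (which indexes the nonzero terms of the Okounkov--Olshanski formula) to the set $\Delta^{\lambda\mu}_{\lambda}$ of equivariant Knutson--Tao puzzles, such that corresponding terms are equal: $$\prod_{u\in[\mu]}\bigl(\lambda_{d+1-T(u)}-c(u)\bigr)=\prod_{p\in\lozenge(P)}\operatorname{ht}(p).$$
   Context: $f^{\lambda/\mu}$ is the number of standard Young tableaux of shape $\lambda/\mu$, $c(i,j)=j-i$ is the content, and $h(u)$ is the hook length of $u$ in $\lambda$. Okounkov--Olshanski formula: $f^{\lambda/\mu}=\frac{|\lambda/\mu|!}{\prod_{u\in[\lambda]}h(u)}\sum_{T}\prod_{u\in[\mu]}(\lambda_{d+1-T(u)}-c(u))$, summed over semistandard Young tableaux $T$ of shape $\mu$ with entries at most $d$; $\mathcal{OOT}(\lambda/\mu)$ is the set of those $T$ with $c(u)<\lambda_{d+1-T(u)}$ for all $u\in[\mu]$. Knutson--Tao formula: $f^{\lambda/\mu}=\frac{|\lambda/\mu|!}{\prod_{u\in[\lambda]}h(u)}\sum_{P\in\Delta^{\lambda\mu}_\lambda}\prod_{p\in\lozenge(P)}\operatorname{ht}(p)$. For a partition $\nu$ fitting in an $a\times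 b$ box ($a$ rows, $b$ columns), $w_\nu$ is the string of $a$ zeros and $b$ ones recording the boundary path of $[\nu]$ (which separates $[\nu]$ from the rest of the box) from the bottom-left to the top-right corner of the box, with $0$ for a vertical step and $1$ for a horizontal step. For partitions $\alpha,\beta,\gamma$ fitting in an $a\times b$ box, $\Delta^{\alpha\beta}_\gamma$ is the set of tilings of an equilateral triangle of side $a+b$ (with horizontal bottom edge and apex on top), along the unit triangular lattice, by the following unit-side pieces with labeled edges, such that labels on shared edges agree, and such that the northwest, northeast, and bottom sides of the big triangle read $w_\alpha,w_\beta,w_\gamma$ respectively, each from left to right: (1) a triangle with all edges labeled $0$; (2) a triangle with all edges labeled $1$; (3) a rhombus which, when placed with its long diagonal vertical, has SW and NE edges labeled $0$ and SE and NW edges labeled $1$; (4) the equivariant piece: a rhombus with vertical long diagonal, with SW and NE edges labeled $1$ and SE and NW edges labeled $0$. Pieces (1)--(3) may be rotated (by multiples of $60^\circ$), piece (4) may not be rotated, and no piece may be reflected. $\lozenge(P)$ is the set of equivariant pieces in $P$, and $\operatorname{ht}(p)\in\{1,\dots,a+b-1\}$ is the distance from the center of $p$ to the bottom side, measured in units of the height $\sqrt3/2$ of a unit triangle. Here $a=d$. *)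

theory Defs
  imports Complex_Main "HOL-Library.FuncSet" "HOL-Library.Product_Plus"
begin

section \<open>Partitions and tableaux\<close>

definition is_partition :: "nat list \<Rightarrow> bool" where
  "is_partition \<nu> \<longleftrightarrow> sorted_wrt (\<ge>) \<nu> \<and> 0 \<notin> set \<nu>"

text \<open>Parts are indexed from 1, and \<open>part \<nu> i = 0\<close> for \<open>i > length \<nu>\<close>.\<close>

definition part :: "nat list \<Rightarrow> nat \<Rightarrow> nat" where
  "part \<nu> i = (if 1 \<le> i \<and> i \<le> length \<nu> then \<nu> ! (i - 1) else 0)"

definition diagram :: "nat list \<Rightarrow> (nat \<times> nat) set" where
  "diagram \<nu> = {(i, j). 1 \<le> i \<and> 1 \<le> j \<and> j \<le> part \<nu> i}"

definition content :: "nat \<times> nat \<Rightarrow> int" where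
  "content u = int (snd u) - int (fst u)"

text \<open>The extensional function space makes a tableau determined by its entries in the diagram.\<close>

definition SSYT :: "nat list \<Rightarrow> nat \<Rightarrow> (nat \<times> nat \<Rightarrow> nat) set" where
  "SSYT \<mu> d = {T \<in> diagram \<mu> \<rightarrow>\<^sub>E {1..d}.
     (\<forall>i j. (i, j) \<in> diagram \<mu> \<and> (i, j + 1) \<in> diagram \<mu> \<longrightarrow> T (i, j) \<le> T (i, j + 1)) \<and>
     (\<forall>i j. (i, j) \<in> diagram \<mu> \<and> (i + 1, j) \<in> diagram \<mu> \<longrightarrow> T (i, j) < T (i + 1, j))}"

definition OO_term :: "nat list \<Rightarrow> nat list \<Rightarrow> (nat \<times> nat \<Rightarrow> nat) \<Rightarrow> int" where
  "OO_term lam \<mu> T = (\<Prod>u\<in>diagram \<mu>. int (part lam (length lam + 1 - T u)) - content u)"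

definition OOT :: "nat list \<Rightarrow> nat list \<Rightarrow> (nat \<times> nat \<Rightarrow> nat) set" where
  "OOT lam \<mu> = {T \<in> SSYT \<mu> (length lam).
     \<forall>u\<in>diagram \<mu>. content u < int (part lam (length lam + 1 - T u))}"

definition fits_in_box :: "nat \<Rightarrow> nat \<Rightarrow> nat list \<Rightarrow> bool" where
  "fits_in_box a b \<nu> \<longleftrightarrow> length \<nu> \<le> a \<and> part \<nu> 1 \<le> b"

text \<open>
  The diagram is drawn in matrix coordinates, so its row \<open>a\<close> is at the bottom of the box: from
  bottom left, the boundary path runs along the bottom of row \<open>i\<close> for \<open>\<nu>\<^sub>i - \<nu>\<^sub>i\<^sub>+\<^sub>1\<close> horizontal
  steps and then up along the end of row \<open>i\<close>, for \<open>i = a, \<dots>, 1\<close>, and ends with \<open>b - \<nu>\<^sub>1\<close>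
  horizontal steps along the top of the box.
\<close>

definition boundary_word :: "nat \<Rightarrow> nat \<Rightarrow> nat list \<Rightarrow> nat list" where
  "boundary_word a b \<nu> =
     concat (map (\<lambda>i. replicate (part \<nu> i - part \<nu> (i + 1)) 1 @ [0]) (rev [1..<a + 1]))
     @ replicate (b - part \<nu> 1) 1"


section \<open>The triangular lattice\<close>

text \<open>
  The point \<open>(x, y)\<close> stands for \<open>x e\<^sub>1 + y e\<^sub>2\<close>, where \<open>e\<^sub>1\<close> and \<open>e\<^sub>2\<close> are unit vectors, \<open>e\<^sub>1\<close>
  horizontal and \<open>e\<^sub>2\<close> at an angle of 60 degrees to it. Thus \<open>y\<close> is the height in units of
  \<open>\<surd>3/2\<close>. Unit edges and unit triangles are represented by their sets of vertices, and a piece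
  by the unit triangles it covers and its labeled boundary edges.
\<close>

type_synonym point = "int \<times> int"
type_synonym edge = "point set"
type_synonym cell = "point set"
type_synonym piece = "cell set \<times> (edge \<times> nat) set"

text \<open>Counterclockwise rotation by 60 degrees about the origin: \<open>e\<^sub>1 \<mapsto> e\<^sub>2\<close>, \<open>e\<^sub>2 \<mapsto> e\<^sub>2 - e\<^sub>1\<close>.\<close>

definition rot60 :: "point \<Rightarrow> point" where
  "rot60 p = (- snd p, fst p + snd p)"

definition move :: "nat \<Rightarrow> point \<Rightarrow> point \<Rightarrow> point" where
  "move k v p = v + (rot60 ^^ k) p"

definition move_piece :: "nat \<Rightarrow> point \<Rightarrow> piece \<Rightarrow> piece" where
  "move_piece k v p =
     ((\<lambda>C. move k v ` C) ` fst p, (\<lambda>(e, l). (move k v ` e, l)) ` snd p)"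

definition unit_cell :: cell where
  "unit_cell = {(0, 0), (1, 0), (0, 1)}"

definition cells_of_triangle :: "nat \<Rightarrow> cell set" where
  "cells_of_triangle n =
     {C. (\<exists>k v. C = move k v ` unit_cell) \<and>
         C \<subseteq> {(x, y). 0 \<le> x \<and> 0 \<le> y \<and> x + y \<le> int n}}"


section \<open>Puzzles\<close>

definition triangle_piece :: "nat \<Rightarrow> piece" where
  "triangle_piece l =
     ({unit_cell}, {({(0, 0), (1, 0)}, l), ({(1, 0), (0, 1)}, l), ({(0, 0), (0, 1)}, l)})"

text \<open>
  The rhombus with vertical long diagonal: its west, east, north and south vertices are
  \<open>(0, 0)\<close>, \<open>(1, 0)\<close>, \<open>(0, 1)\<close> and \<open>(1, -1)\<close>. The label \<open>l\<close> is on its SW and NE edges and \<open>m\<close> on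
  its SE and NW edges.
\<close>

definition vertical_rhombus :: "nat \<Rightarrow> nat \<Rightarrow> piece" where
  "vertical_rhombus l m =
     ({{(0, 0), (1, 0), (0, 1)}, {(0, 0), (1, 0), (1, -1)}},
      {({(0, 0), (1, -1)}, l), ({(1, 0), (0, 1)}, l),
       ({(1, 0), (1, -1)}, m), ({(0, 0), (0, 1)}, m)})"

definition ordinary_pieces :: "piece set" where
  "ordinary_pieces =
     {move_piece k v p | k v p. p \<in> {triangle_piece 0, triangle_piece 1, vertical_rhombus 0 1}}"

definition equivariant_pieces :: "piece set" where
  "equivariant_pieces = {move_piece 0 v (vertical_rhombus 1 0) | v. True}"

text \<open>
  The big triangle has vertices \<open>(0, 0)\<close>, \<open>(n, 0)\<close> and apex \<open>(0, n)\<close>, where \<open>n = a + b\<close>. The three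
  last conditions read its NW, NE and bottom sides, each from left to right.
\<close>

definition KT_puzzles ::
    "nat \<Rightarrow> nat \<Rightarrow> nat list \<Rightarrow> nat list \<Rightarrow> nat list \<Rightarrow> piece set set" where
  "KT_puzzles a b \<alpha> \<beta> \<gamma> = {P.
     P \<subseteq> ordinary_pieces \<union> equivariant_pieces \<and>
     (\<forall>p\<in>P. \<forall>q\<in>P. p \<noteq> q \<longrightarrow> fst p \<inter> fst q = {}) \<and>
     (\<Union>p\<in>P. fst p) = cells_of_triangle (a + b) \<and>
     (\<forall>p\<in>P. \<forall>q\<in>P. \<forall>e l l'. (e, l) \<in> snd p \<and> (e, l') \<in> snd q \<longrightarrow> l = l') \<and>
     (\<forall>i < a + b. ({(0, int i), (0, int i + 1)}, boundary_word a b \<alpha> ! i)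
        \<in> (\<Union>p\<in>P. snd p)) \<and>
     (\<forall>i < a + b. ({(int i, int (a + b) - int i), (int i + 1, int (a + b) - int i - 1)},
          boundary_word a b \<beta> ! i) \<in> (\<Union>p\<in>P. snd p)) \<and>
     (\<forall>i < a + b. ({(int i, 0), (int i + 1, 0)}, boundary_word a b \<gamma> ! i)
        \<in> (\<Union>p\<in>P. snd p))}"

definition lozenges :: "piece set \<Rightarrow> piece set" where
  "lozenges P = P \<inter> equivariant_pieces"

text \<open>The center of a rhombus is the mean of its vertices; the bottom side is at height 0.\<close>

definition ht :: "piece \<Rightarrow> real" where
  "ht p = (\<Sum>v\<in>\<Union>(fst p). real_of_int (snd v)) / real (card (\<Union>(fst p)))"

end

theory Submission
  imports Defs
begin

text \<open>
  A puzzle is read along the lines parallel to the northeast side of the big triangle. The strip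
  between two consecutive lines ends in one edge of the northwest side and one edge of the bottom
  side, and these have the same label because both sides read the word of \<open>lam\<close>.

  Give the edge inside a rhombus the label 2 or, in an equivariant rhombus, 3. A tiling then becomes
  a labeling of all edges in which every unit triangle shows one of six triples of labels, and no
  information is lost (\<open>puzzle_of_label_of\<close>, \<open>is_tiling_puzzle_of\<close>, \<open>label_of_puzzle_of\<close>). Since
  the two ends of a strip agree, the number of labels 2 on a line does not change from one line to
  the next (\<open>strip_twos\<close>); it is 0 on the first line, so every line carries a word in 0 and 1. A
  strip whose ends have label 1 only appends a 1 to this word (\<open>strip_one\<close>). A strip whose ends have
  label 0 puts a 0 in front of the word and moves zeros to the right, each of them over some of the
  ones that follow it. In terms of the number \<open>Z k x\<close> of zeros among the first \<open>x\<close> letters on line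
  \<open>k\<close> this means \<open>Z s x \<le> Z (s + 1) x\<close> and \<open>Z (s + 1) (x + 1) \<le> Z s x + 1\<close> (\<open>strip_zero\<close>), and
  conversely two words so related determine the labels inside the strip (\<open>valid_labeling\<close>,
  \<open>labeling_of_line_words\<close>). So puzzles are arrays \<open>Z\<close> of numbers whose last row belongs to the word
  of \<open>\<mu>\<close>.

  A word with \<open>t\<close> zeros is the boundary path of a partition with at most \<open>t\<close> parts, which contains
  \<open>(i, j)\<close> if and only if at most \<open>t - i\<close> of the first \<open>j + t - i\<close> letters are zeros
  (\<open>diagonal_count_le_iff\<close>). The two inequalities become the two conditions for a horizontal strip.
  The array is therefore a chain of partitions that grows by horizontal strips from the empty
  partition to \<open>\<mu>\<close>, that is, a semistandard tableau \<open>T\<close>: the \<open>t\<close>-th partition consists of the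
  entries at most \<open>t\<close>. The \<open>t\<close>-th zero of the word of \<open>lam\<close> is its letter number
  \<open>part lam (d + 1 - t) + t - 1\<close>, counted from 0, and the requirement that the word on the next line
  has all its \<open>t\<close> zeros within the line is the inequality that defines \<open>OOT\<close>.

  In the strip that belongs to this letter the equivariant pieces lie at the ones that a zero has
  moved past, and these ones are the cells \<open>u = (i, j)\<close> with \<open>T u = t\<close>. The piece of
  \<open>u\<close> is at distance \<open>j + t - 1 - i\<close> from the left end of the strip, so its height is \<open>part lam (d + 1 - t) - content u\<close>
  (\<open>equivariant_cell_of_entry\<close>, \<open>entry_of_equivariant_cell\<close>).
\<close>

section \<open>Pieces in lattice coordinates\<close>

text \<open>
  The three directions of edges. The edges \<open>rise\<close> are parallel to the northwest side and the edges
  \<open>fall\<close> to the northeast side. The cells \<open>up x y\<close> and \<open>down x y\<close> lie above and below \<open>hor x y\<close>.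
\<close>
definition hor :: "int \<Rightarrow> int \<Rightarrow> edge" where "hor x y = {(x, y), (x + 1, y)}"
definition rise :: "int \<Rightarrow> int \<Rightarrow> edge" where "rise x y = {(x, y), (x, y + 1)}"
definition fall :: "int \<Rightarrow> int \<Rightarrow> edge" where "fall x y = {(x + 1, y), (x, y + 1)}"

definition up :: "int \<Rightarrow> int \<Rightarrow> cell" where "up x y = {(x, y), (x + 1, y), (x, y + 1)}"
definition down :: "int \<Rightarrow> int \<Rightarrow> cell" where "down x y = {(x, y), (x + 1, y), (x + 1, y - 1)}"

lemma edge_eq_iff [simp]:
  "hor x y = hor x' y' \<longleftrightarrow> x = x' \<and> y = y'"
  "rise x y = rise x' y' \<longleftrightarrow> x = x' \<and> y = y'"
  "fall x y = fall x' y' \<longleftrightarrow> x = x' \<and> y = y'"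
  "hor x y \<noteq> rise x' y'" "rise x' y' \<noteq> hor x y"
  "hor x y \<noteq> fall x' y'" "fall x' y' \<noteq> hor x y"
  "rise x y \<noteq> fall x' y'" "fall x' y' \<noteq> rise x y"
  by (auto simp: hor_def rise_def fall_def doubleton_eq_iff)

lemma down_ne_up [simp]: "down x y \<noteq> up x' y'"
proof
  assume *: "down x y = up x' y'"
  then have "(x', y') \<in> down x y" "(x' + 1, y') \<in> down x y" "(x', y' + 1) \<in> down x y"
    by (auto simp: up_def)
  then show False by (auto simp: down_def)
qed

lemma cell_eq_iff [simp]:
  "up x y = up x' y' \<longleftrightarrow> x = x' \<and> y = y'"
  "down x y = down x' y' \<longleftrightarrow> x = x' \<and> y = y'"
  "up x' y' \<noteq> down x y"
proof -
  have "x = x' \<and> y = y'" if "up x y = up x' y'"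
  proof -
    have "(x', y') \<in> up x y" "(x' + 1, y') \<in> up x y" "(x', y' + 1) \<in> up x y"
      unfolding that by (auto simp: up_def)
    then show ?thesis by (auto simp: up_def)
  qed
  then show "up x y = up x' y' \<longleftrightarrow> x = x' \<and> y = y'" by blast
  have "x = x' \<and> y = y'" if "down x y = down x' y'"
  proof -
    have "(x', y') \<in> down x y" "(x' + 1, y') \<in> down x y" "(x' + 1, y' - 1) \<in> down x y"
      unfolding that by (auto simp: down_def)
    then show ?thesis by (auto simp: down_def)
  qed
  then show "down x y = down x' y' \<longleftrightarrow> x = x' \<and> y = y'" by blast
  show "up x' y' \<noteq> down x y" using down_ne_up by metis
qed

text \<open>
  The name of a rhombus tells the direction of its short diagonal, which lies at \<open>x y\<close>. An ordinary
  rhombus occurs with all three directions; \<open>rhombus_hor 1 0\<close> is the equivariant one.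
\<close>
definition up_triangle :: "nat \<Rightarrow> int \<Rightarrow> int \<Rightarrow> piece" where
  "up_triangle l x y = ({up x y}, {(hor x y, l), (rise x y, l), (fall x y, l)})"

definition down_triangle :: "nat \<Rightarrow> int \<Rightarrow> int \<Rightarrow> piece" where
  "down_triangle l x y =
     ({down x y}, {(hor x y, l), (rise (x + 1) (y - 1), l), (fall x (y - 1), l)})"

definition rhombus_hor :: "nat \<Rightarrow> nat \<Rightarrow> int \<Rightarrow> int \<Rightarrow> piece" where
  "rhombus_hor l m x y = ({up x y, down x y},
     {(fall x (y - 1), l), (fall x y, l), (rise (x + 1) (y - 1), m), (rise x y, m)})"

definition rhombus_rise :: "int \<Rightarrow> int \<Rightarrow> piece" where
  "rhombus_rise x y = ({up x y, down (x - 1) (y + 1)},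
     {(fall x y, 1), (hor x y, 0), (hor (x - 1) (y + 1), 0), (fall (x - 1) y, 1)})"

definition rhombus_fall :: "int \<Rightarrow> int \<Rightarrow> piece" where
  "rhombus_fall x y = ({up x y, down x (y + 1)},
     {(rise x y, 0), (hor x y, 1), (hor x (y + 1), 1), (rise (x + 1) y, 0)})"

lemmas piece_defs = up_triangle_def down_triangle_def rhombus_hor_def rhombus_rise_def
  rhombus_fall_def

lemma rot60_pow_6 [simp]: "rot60 ^^ 6 = id"
  by (simp add: eval_nat_numeral rot60_def fun_eq_iff)

lemma rot60_pow_mod: "rot60 ^^ (k mod 6) = rot60 ^^ k"
proof -
  have "rot60 ^^ (6 * q) = id" for q
    by (simp add: funpow_mult [symmetric] id_funpow)
  then have "rot60 ^^ (k mod 6 + 6 * (k div 6)) = rot60 ^^ (k mod 6)"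
    by (simp only: funpow_add comp_id)
  then show ?thesis by simp
qed

lemma rot60_pows:
  "rot60 ^^ 0 = (\<lambda>p. p)"
  "rot60 ^^ 1 = (\<lambda>p. (- snd p, fst p + snd p))"
  "rot60 ^^ 2 = (\<lambda>p. (- fst p - snd p, fst p))"
  "rot60 ^^ 3 = (\<lambda>p. (- fst p, - snd p))"
  "rot60 ^^ 4 = (\<lambda>p. (snd p, - fst p - snd p))"
  "rot60 ^^ 5 = (\<lambda>p. (fst p + snd p, - fst p))"
  by (simp_all add: eval_nat_numeral rot60_def fun_eq_iff)

text \<open>
  Only six of the moves \<open>move k\<close> differ, so statements on pieces reduce to finitely many computations.
\<close>
lemma move_reduce:
  obtains j where "j \<in> {0, 1, 2, 3, 4, 5}" "move k = move j" "move_piece k = move_piece j"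
proof -
  have "k mod 6 < 6" by simp
  then have "k mod 6 \<in> {0, 1, 2, 3, 4, 5}" by auto
  moreover have m: "move k = move (k mod 6)"
    unfolding move_def rot60_pow_mod ..
  moreover have "move_piece k = move_piece (k mod 6)"
    unfolding move_piece_def using m by simp
  ultimately show thesis by (rule that)
qed

lemma moves:
  "move 0 (x, y) (a, b) = (x + a, y + b)"
  "move 1 (x, y) (a, b) = (x - b, y + (a + b))"
  "move 2 (x, y) (a, b) = (x - (a + b), y + a)"
  "move 3 (x, y) (a, b) = (x - a, y - b)"
  "move 4 (x, y) (a, b) = (x + b, y - (a + b))"
  "move 5 (x, y) (a, b) = (x + (a + b), y - a)"
  unfolding move_def rot60_pows by simp_all

lemma move_unit_cell:
  "move 0 (x, y) ` unit_cell = up x y"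
  "move 1 (x, y) ` unit_cell = down (x - 1) (y + 1)"
  "move 2 (x, y) ` unit_cell = up (x - 1) y"
  "move 3 (x, y) ` unit_cell = down (x - 1) y"
  "move 4 (x, y) ` unit_cell = up x (y - 1)"
  "move 5 (x, y) ` unit_cell = down x y"
  by (simp_all only: unit_cell_def image_insert image_empty moves up_def down_def)
    (simp_all add: insert_commute)

lemma move_triangle_piece:
  "move_piece 0 (x, y) (triangle_piece l) = up_triangle l x y"
  "move_piece 1 (x, y) (triangle_piece l) = down_triangle l (x - 1) (y + 1)"
  "move_piece 2 (x, y) (triangle_piece l) = up_triangle l (x - 1) y"
  "move_piece 3 (x, y) (triangle_piece l) = down_triangle l (x - 1) y"
  "move_piece 4 (x, y) (triangle_piece l) = up_triangle l x (y - 1)"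
  "move_piece 5 (x, y) (triangle_piece l) = down_triangle l x y"
  by (simp_all only: move_piece_def triangle_piece_def fst_conv snd_conv move_unit_cell
      image_insert image_empty prod.case moves piece_defs hor_def rise_def fall_def)
    (simp_all add: insert_commute)

lemma move_vertical_rhombus:
  "move_piece 0 (x, y) (vertical_rhombus l m) = rhombus_hor l m x y"
  "move_piece 1 (x, y) (vertical_rhombus 0 1) = rhombus_rise x y"
  "move_piece 2 (x, y) (vertical_rhombus 0 1) = rhombus_fall (x - 1) y"
  "move_piece 3 (x, y) (vertical_rhombus 0 1) = rhombus_hor 0 1 (x - 1) y"
  "move_piece 4 (x, y) (vertical_rhombus 0 1) = rhombus_rise x (y - 1)"
  "move_piece 5 (x, y) (vertical_rhombus 0 1) = rhombus_fall x (y - 1)"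
  by (simp_all only: move_piece_def vertical_rhombus_def fst_conv snd_conv
      image_insert image_empty prod.case moves piece_defs hor_def rise_def fall_def
      up_def down_def)
    (simp_all add: insert_commute)

lemma ordinary_piece_cases:
  assumes "p \<in> ordinary_pieces"
  obtains l x y where "l \<le> 1" "p = up_triangle l x y \<or> p = down_triangle l x y"
    | x y where "p = rhombus_hor 0 1 x y \<or> p = rhombus_rise x y \<or> p = rhombus_fall x y"
proof -
  obtain k v q where p: "p = move_piece k v q"
    and q: "q \<in> {triangle_piece 0, triangle_piece 1, vertical_rhombus 0 1}"
    using assms unfolding ordinary_pieces_def by blast
  obtain x y where v: "v = (x, y)" by (cases v)
  obtain j where j: "j \<in> {0, 1, 2, 3, 4, 5}" and "move_piece k = move_piece j"
    by (rule move_reduce)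
  then have p': "p = move_piece j (x, y) q"
    using p v by simp
  consider l where "l \<le> 1" "q = triangle_piece l" | "q = vertical_rhombus 0 1"
    using q by fastforce
  then show thesis
  proof cases
    case 1
    have "(\<exists>x y. p = up_triangle l x y) \<or> (\<exists>x y. p = down_triangle l x y)"
      using j unfolding p' 1(2) by (elim insertE emptyE; simp only: move_triangle_piece) blast+
    then show thesis using that(1) \<open>l \<le> 1\<close> by blast
  next
    case 2
    have "(\<exists>x y. p = rhombus_hor 0 1 x y) \<or> (\<exists>x y. p = rhombus_rise x y) \<or>
        (\<exists>x y. p = rhombus_fall x y)"
      using j unfolding p' 2 by (elim insertE emptyE; simp only: move_vertical_rhombus) blast+
    then show thesis using that(2) by blast
  qed
qed

lemma equivariant_pieces_eq: "equivariant_pieces = {rhombus_hor 1 0 x y | x y. True}"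
proof -
  have "(\<exists>v. p = move_piece 0 v (vertical_rhombus 1 0)) \<longleftrightarrow> (\<exists>x y. p = rhombus_hor 1 0 x y)" for p
    unfolding split_paired_Ex move_vertical_rhombus(1) ..
  then show ?thesis unfolding equivariant_pieces_def by simp
qed

lemma ordinary_piecesI:
  "l \<le> 1 \<Longrightarrow> up_triangle l x y \<in> ordinary_pieces"
  "l \<le> 1 \<Longrightarrow> down_triangle l x y \<in> ordinary_pieces"
  "rhombus_hor 0 1 x y \<in> ordinary_pieces"
  "rhombus_rise x y \<in> ordinary_pieces"
  "rhombus_fall x y \<in> ordinary_pieces"
proof -
  have ord: "move_piece k v q \<in> ordinary_pieces"
    if "q \<in> {triangle_piece 0, triangle_piece 1, vertical_rhombus 0 1}" for k v q
    using that unfolding ordinary_pieces_def by blast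
  have "l \<le> 1 \<Longrightarrow> triangle_piece l \<in> {triangle_piece 0, triangle_piece 1, vertical_rhombus 0 1}"
    using le_neq_implies_less less_one by blast
  then show "l \<le> 1 \<Longrightarrow> up_triangle l x y \<in> ordinary_pieces"
    "l \<le> 1 \<Longrightarrow> down_triangle l x y \<in> ordinary_pieces"
    using ord[of "triangle_piece l" 0 "(x, y)"] ord[of "triangle_piece l" 5 "(x, y)"]
    unfolding move_triangle_piece by blast+
  show "rhombus_hor 0 1 x y \<in> ordinary_pieces" "rhombus_rise x y \<in> ordinary_pieces"
    using ord[of "vertical_rhombus 0 1" 0 "(x, y)"] ord[of "vertical_rhombus 0 1" 1 "(x, y)"]
    unfolding move_vertical_rhombus by blast+
  show "rhombus_fall x y \<in> ordinary_pieces"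
    using ord[of "vertical_rhombus 0 1" 2 "(x + 1, y)"]
    unfolding move_vertical_rhombus by simp
qed

lemma unit_cell_moves: "(\<exists>k v. C = move k v ` unit_cell) \<longleftrightarrow> (\<exists>x y. C = up x y \<or> C = down x y)"
proof
  assume "\<exists>k v. C = move k v ` unit_cell"
  then obtain k x y where C: "C = move k (x, y) ` unit_cell"
    unfolding split_paired_Ex by blast
  obtain j where "j \<in> {0, 1, 2, 3, 4, 5}" "move k = move j"
    by (rule move_reduce)
  then have "j \<in> {0, 1, 2, 3, 4, 5}" "C = move j (x, y) ` unit_cell"
    using C by simp_all
  then show "\<exists>x y. C = up x y \<or> C = down x y"
    by (elim insertE emptyE; simp only: move_unit_cell) blast+
next
  assume "\<exists>x y. C = up x y \<or> C = down x y"
  then show "\<exists>k v. C = move k v ` unit_cell"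
    using move_unit_cell(1,6) by metis
qed

lemma up_in_triangle: "up x y \<in> cells_of_triangle n \<longleftrightarrow> 0 \<le> x \<and> 0 \<le> y \<and> x + y < int n"
proof -
  have "up x y \<subseteq> {(x, y). 0 \<le> x \<and> 0 \<le> y \<and> x + y \<le> int n} \<longleftrightarrow>
      0 \<le> x \<and> 0 \<le> y \<and> x + y < int n"
    unfolding up_def by auto
  then show ?thesis
    unfolding cells_of_triangle_def mem_Collect_eq unit_cell_moves by blast
qed

lemma down_in_triangle: "down x y \<in> cells_of_triangle n \<longleftrightarrow> 0 \<le> x \<and> 1 \<le> y \<and> x + y < int n"
proof -
  have "down x y \<subseteq> {(x, y). 0 \<le> x \<and> 0 \<le> y \<and> x + y \<le> int n} \<longleftrightarrow>
      0 \<le> x \<and> 1 \<le> y \<and> x + y < int n"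
    unfolding down_def by auto
  then show ?thesis
    unfolding cells_of_triangle_def mem_Collect_eq unit_cell_moves by blast
qed

lemma cell_cases:
  assumes "C \<in> cells_of_triangle n"
  obtains x y where "C = up x y" | x y where "C = down x y"
  using assms unfolding cells_of_triangle_def mem_Collect_eq unit_cell_moves by blast

section \<open>Tilings as edge labelings\<close>

text \<open>
  The labels of a cell on its edges \<open>rise\<close>, \<open>fall\<close> and \<open>hor\<close>, in this order. The first two triples
  are the triangles. The next three are the halves of the ordinary rhombus, with 2 on the cut; they
  are cyclic shifts of each other because the rhombus may be rotated by 120 degrees. The last one is
  the half of the equivariant rhombus. Up and down cells have the same triples, since a rotation by
  180 degrees exchanges the halves of each rhombus and preserves the directions of edges.
\<close>
definition admissible :: "nat \<Rightarrow> nat \<Rightarrow> nat \<Rightarrow> bool" where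
  "admissible a b h \<longleftrightarrow> (a, b, h) \<in> {(0, 0, 0), (1, 1, 1), (1, 0, 2), (2, 1, 0), (0, 2, 1), (0, 1, 3)}"

text \<open>The labels of a cell tell which piece covers it.\<close>
definition piece_at_up :: "(edge \<Rightarrow> nat) \<Rightarrow> int \<Rightarrow> int \<Rightarrow> piece" where
  "piece_at_up L x y =
     (if L (hor x y) = 2 then rhombus_hor 0 1 x y
      else if L (hor x y) = 3 then rhombus_hor 1 0 x y
      else if L (rise x y) = 2 then rhombus_rise x y
      else if L (fall x y) = 2 then rhombus_fall x y
      else up_triangle (L (hor x y)) x y)"

definition piece_at_down :: "(edge \<Rightarrow> nat) \<Rightarrow> int \<Rightarrow> int \<Rightarrow> piece" where
  "piece_at_down L x y =
     (if L (hor x y) = 2 then rhombus_hor 0 1 x y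
      else if L (hor x y) = 3 then rhombus_hor 1 0 x y
      else if L (rise (x + 1) (y - 1)) = 2 then rhombus_rise (x + 1) (y - 1)
      else if L (fall x (y - 1)) = 2 then rhombus_fall x (y - 1)
      else down_triangle (L (hor x y)) x y)"

definition admissible_up :: "(edge \<Rightarrow> nat) \<Rightarrow> int \<Rightarrow> int \<Rightarrow> bool" where
  "admissible_up L x y \<longleftrightarrow> admissible (L (rise x y)) (L (fall x y)) (L (hor x y))"

definition admissible_down :: "(edge \<Rightarrow> nat) \<Rightarrow> int \<Rightarrow> int \<Rightarrow> bool" where
  "admissible_down L x y \<longleftrightarrow>
     admissible (L (rise (x + 1) (y - 1))) (L (fall x (y - 1))) (L (hor x y))"

definition valid_labeling :: "nat \<Rightarrow> (edge \<Rightarrow> nat) \<Rightarrow> bool" where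
  "valid_labeling n L \<longleftrightarrow>
     (\<forall>x y. up x y \<in> cells_of_triangle n \<longrightarrow> admissible_up L x y) \<and>
     (\<forall>x y. down x y \<in> cells_of_triangle n \<longrightarrow> admissible_down L x y) \<and>
     (\<forall>i<n. L (rise 0 (int i)) \<le> 1 \<and> L (fall (int i) (int n - 1 - int i)) \<le> 1 \<and>
        L (hor (int i) 0) \<le> 1)"

definition puzzle_of :: "nat \<Rightarrow> (edge \<Rightarrow> nat) \<Rightarrow> piece set" where
  "puzzle_of n L = {piece_at_up L x y | x y. up x y \<in> cells_of_triangle n} \<union>
     {piece_at_down L x y | x y. down x y \<in> cells_of_triangle n}"

lemma puzzle_ofI:
  "up x y \<in> cells_of_triangle n \<Longrightarrow> piece_at_up L x y \<in> puzzle_of n L"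
  "down x y \<in> cells_of_triangle n \<Longrightarrow> piece_at_down L x y \<in> puzzle_of n L"
  unfolding puzzle_of_def by auto

lemma puzzle_ofE:
  assumes "p \<in> puzzle_of n L"
  obtains x y where "up x y \<in> cells_of_triangle n" "p = piece_at_up L x y"
    | x y where "down x y \<in> cells_of_triangle n" "p = piece_at_down L x y"
  using assms unfolding puzzle_of_def by auto

definition is_tiling :: "nat \<Rightarrow> piece set \<Rightarrow> bool" where
  "is_tiling n P \<longleftrightarrow> P \<subseteq> ordinary_pieces \<union> equivariant_pieces \<and>
     (\<forall>p\<in>P. \<forall>q\<in>P. p \<noteq> q \<longrightarrow> fst p \<inter> fst q = {}) \<and>
     (\<Union>p\<in>P. fst p) = cells_of_triangle n \<and>
     (\<forall>p\<in>P. \<forall>q\<in>P. \<forall>e l l'. (e, l) \<in> snd p \<and> (e, l') \<in> snd q \<longrightarrow> l = l')"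

definition labeled_by :: "piece set \<Rightarrow> edge \<Rightarrow> nat \<Rightarrow> bool" where
  "labeled_by P e l \<longleftrightarrow> (\<exists>p\<in>P. (e, l) \<in> snd p)"

text \<open>
  In a tiling exactly the inner edges of rhombi have no label, so a missing label is 3 or 2 according
  to whether the rhombus is equivariant.
\<close>
definition label_of :: "piece set \<Rightarrow> edge \<Rightarrow> nat" where
  "label_of P e = (if \<exists>l. labeled_by P e l then THE l. labeled_by P e l
     else if \<exists>x y. e = hor x y \<and> rhombus_hor 1 0 x y \<in> P then 3 else 2)"

lemma piece_cases:
  assumes "p \<in> ordinary_pieces \<union> equivariant_pieces"
  obtains l x y where "l \<le> 1" "p = up_triangle l x y"
    | l x y where "l \<le> 1" "p = down_triangle l x y"
    | x y where "p = rhombus_hor 0 1 x y"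
    | x y where "p = rhombus_hor 1 0 x y"
    | x y where "p = rhombus_rise x y"
    | x y where "p = rhombus_fall x y"
  using assms
proof
  assume "p \<in> ordinary_pieces"
  then show ?thesis
  proof (cases rule: ordinary_piece_cases)
    case (1 l x y) then show ?thesis using that(1,2)[of l x y] by blast
  next
    case (2 x y) then show ?thesis using that(3,5,6)[of x y] by blast
  qed
next
  assume "p \<in> equivariant_pieces"
  then show ?thesis using that(4) unfolding equivariant_pieces_eq by blast
qed

text \<open>
  This separates boundary edges from inner edges: a rhombus that has the edge inside covers the cells
  on both sides, and would overlap any piece that has it on its boundary.
\<close>
lemma one_side_of_labeled_edge:
  assumes "p \<in> ordinary_pieces \<union> equivariant_pieces"
  shows "(hor x y, l) \<in> snd p \<Longrightarrow> up x y \<in> fst p \<longleftrightarrow> down x y \<notin> fst p"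
    and "(rise x y, l) \<in> snd p \<Longrightarrow> up x y \<in> fst p \<longleftrightarrow> down (x - 1) (y + 1) \<notin> fst p"
    and "(fall x y, l) \<in> snd p \<Longrightarrow> up x y \<in> fst p \<longleftrightarrow> down x (y + 1) \<notin> fst p"
  using assms by (cases p rule: piece_cases; auto simp: piece_defs)+

context
  fixes n P
  assumes tiling: "is_tiling n P"
begin

lemma tilingD:
  shows pieces: "p \<in> P \<Longrightarrow> p \<in> ordinary_pieces \<union> equivariant_pieces"
    and piece_unique: "p \<in> P \<Longrightarrow> q \<in> P \<Longrightarrow> c \<in> fst p \<Longrightarrow> c \<in> fst q \<Longrightarrow> p = q"
    and cells: "p \<in> P \<Longrightarrow> c \<in> fst p \<Longrightarrow> c \<in> cells_of_triangle n"
    and label_unique: "p \<in> P \<Longrightarrow> q \<in> P \<Longrightarrow> (e, l) \<in> snd p \<Longrightarrow> (e, l') \<in> snd q \<Longrightarrow> l = l'"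
proof -
  note t = tiling[unfolded is_tiling_def]
  show "p \<in> P \<Longrightarrow> p \<in> ordinary_pieces \<union> equivariant_pieces"
    using t[THEN conjunct1] by (rule subsetD)
  show "p \<in> P \<Longrightarrow> q \<in> P \<Longrightarrow> c \<in> fst p \<Longrightarrow> c \<in> fst q \<Longrightarrow> p = q"
    using t[THEN conjunct2, THEN conjunct1] by blast
  show "p \<in> P \<Longrightarrow> c \<in> fst p \<Longrightarrow> c \<in> cells_of_triangle n"
    using t[THEN conjunct2, THEN conjunct2, THEN conjunct1] by blast
  show "p \<in> P \<Longrightarrow> q \<in> P \<Longrightarrow> (e, l) \<in> snd p \<Longrightarrow> (e, l') \<in> snd q \<Longrightarrow> l = l'"
    using t[THEN conjunct2, THEN conjunct2, THEN conjunct2] by metis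
qed

lemma covering_piece:
  assumes "c \<in> cells_of_triangle n"
  obtains p where "p \<in> P" "c \<in> fst p"
proof -
  have "c \<in> (\<Union>p\<in>P. fst p)"
    using assms tiling[unfolded is_tiling_def, THEN conjunct2, THEN conjunct2, THEN conjunct1]
    by simp
  then show thesis using that by blast
qed

lemma label_of_labeled:
  assumes "p \<in> P" "(e, l) \<in> snd p"
  shows "label_of P e = l"
proof -
  have "labeled_by P e l" unfolding labeled_by_def using assms by blast
  moreover have "l' = l" if "labeled_by P e l'" for l'
    using label_unique[OF assms(1) _ assms(2)] that unfolding labeled_by_def by metis
  ultimately have "(THE l. labeled_by P e l) = l" by (rule the_equality)
  then show ?thesis unfolding label_of_def using \<open>labeled_by P e l\<close> by auto
qed

lemma inner_edge_unlabeled: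
  assumes "p \<in> P"
  shows "up x y \<in> fst p \<Longrightarrow> down x y \<in> fst p \<Longrightarrow> \<not> labeled_by P (hor x y) l"
    and "up x y \<in> fst p \<Longrightarrow> down (x - 1) (y + 1) \<in> fst p \<Longrightarrow> \<not> labeled_by P (rise x y) l"
    and "up x y \<in> fst p \<Longrightarrow> down x (y + 1) \<in> fst p \<Longrightarrow> \<not> labeled_by P (fall x y) l"
proof -
  have no: False
    if "q \<in> P" "c \<in> fst p" "c' \<in> fst p" "c \<in> fst q \<longleftrightarrow> c' \<notin> fst q" for q c c'
    using piece_unique[OF assms \<open>q \<in> P\<close>] that by blast
  note side = one_side_of_labeled_edge[OF pieces]
  show "up x y \<in> fst p \<Longrightarrow> down x y \<in> fst p \<Longrightarrow> \<not> labeled_by P (hor x y) l"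
    unfolding labeled_by_def using no side(1) by metis
  show "up x y \<in> fst p \<Longrightarrow> down (x - 1) (y + 1) \<in> fst p \<Longrightarrow> \<not> labeled_by P (rise x y) l"
    unfolding labeled_by_def using no side(2) by metis
  show "up x y \<in> fst p \<Longrightarrow> down x (y + 1) \<in> fst p \<Longrightarrow> \<not> labeled_by P (fall x y) l"
    unfolding labeled_by_def using no side(3) by metis
qed

lemma label_of_inner:
  shows "rhombus_hor 0 1 x y \<in> P \<Longrightarrow> label_of P (hor x y) = 2"
    and "rhombus_hor 1 0 x y \<in> P \<Longrightarrow> label_of P (hor x y) = 3"
    and "rhombus_rise x y \<in> P \<Longrightarrow> label_of P (rise x y) = 2"
    and "rhombus_fall x y \<in> P \<Longrightarrow> label_of P (fall x y) = 2"
proof -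
  assume *: "rhombus_hor 0 1 x y \<in> P"
  have "(fall x y, 0) \<in> snd (rhombus_hor 0 1 x y)" "(fall x y, 0) \<notin> snd (rhombus_hor 1 0 x y)"
    by (simp_all add: rhombus_hor_def)
  then have "rhombus_hor 0 1 x y \<noteq> rhombus_hor 1 0 x y" by metis
  then have "rhombus_hor 1 0 x y \<notin> P"
    using piece_unique[OF *, of "rhombus_hor 1 0 x y" "up x y"]
    by (metis fst_conv insertI1 rhombus_hor_def)
  moreover have "\<not> labeled_by P (hor x y) l" for l
    using inner_edge_unlabeled(1)[OF *] by (simp add: rhombus_hor_def)
  ultimately show "label_of P (hor x y) = 2" unfolding label_of_def by auto
next
  assume *: "rhombus_hor 1 0 x y \<in> P"
  moreover have "\<not> labeled_by P (hor x y) l" for l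
    using inner_edge_unlabeled(1)[OF *] by (simp add: rhombus_hor_def)
  ultimately show "label_of P (hor x y) = 3" unfolding label_of_def by auto
next
  assume *: "rhombus_rise x y \<in> P"
  moreover have "\<not> labeled_by P (rise x y) l" for l
    using inner_edge_unlabeled(2)[OF *] by (simp add: rhombus_rise_def)
  ultimately show "label_of P (rise x y) = 2" unfolding label_of_def by auto
next
  assume *: "rhombus_fall x y \<in> P"
  moreover have "\<not> labeled_by P (fall x y) l" for l
    using inner_edge_unlabeled(3)[OF *] by (simp add: rhombus_fall_def)
  ultimately show "label_of P (fall x y) = 2" unfolding label_of_def by auto
qed

lemma labels_of_piece:
  assumes "p \<in> P"
  shows "up x y \<in> fst p \<Longrightarrow> admissible_up (label_of P) x y \<and> p = piece_at_up (label_of P) x y"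
    and "down x y \<in> fst p \<Longrightarrow> admissible_down (label_of P) x y \<and> p = piece_at_down (label_of P) x y"
proof -
  note lab = label_of_labeled[OF assms]
  have piece: "p \<in> ordinary_pieces \<union> equivariant_pieces"
    using assms by (rule pieces)
  note defs = admissible_up_def admissible_down_def admissible_def piece_at_up_def piece_at_down_def
    piece_defs
  show "admissible_up (label_of P) x y \<and> p = piece_at_up (label_of P) x y" if "up x y \<in> fst p"
    using piece
  proof (cases p rule: piece_cases)
    case (1 l x' y')
    then show ?thesis using that lab[of "hor x y" l] lab[of "rise x y" l] lab[of "fall x y" l]
      by (auto simp: defs)
  next
    case (2 l x' y') then show ?thesis using that by (simp add: defs)
  next
    case (3 x' y')
    then show ?thesis using that lab[of "rise x y" 1] lab[of "fall x y" 0]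
        label_of_inner(1)[of x y] assms by (simp add: defs)
  next
    case (4 x' y')
    then show ?thesis using that lab[of "rise x y" 0] lab[of "fall x y" 1]
        label_of_inner(2)[of x y] assms by (simp add: defs)
  next
    case (5 x' y')
    then show ?thesis using that lab[of "hor x y" 0] lab[of "fall x y" 1]
        label_of_inner(3)[of x y] assms by (simp add: defs)
  next
    case (6 x' y')
    then show ?thesis using that lab[of "hor x y" 1] lab[of "rise x y" 0]
        label_of_inner(4)[of x y] assms by (simp add: defs)
  qed
  show "admissible_down (label_of P) x y \<and> p = piece_at_down (label_of P) x y"
    if "down x y \<in> fst p"
    using piece
  proof (cases p rule: piece_cases)
    case (1 l x' y') then show ?thesis using that by (simp add: defs)
  next
    case (2 l x' y')
    then show ?thesis
      using that lab[of "hor x y" l] lab[of "rise (x + 1) (y - 1)" l] lab[of "fall x (y - 1)" l]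
      by (auto simp: defs)
  next
    case (3 x' y')
    then show ?thesis using that lab[of "rise (x + 1) (y - 1)" 1] lab[of "fall x (y - 1)" 0]
        label_of_inner(1)[of x y] assms by (simp add: defs)
  next
    case (4 x' y')
    then show ?thesis using that lab[of "rise (x + 1) (y - 1)" 0] lab[of "fall x (y - 1)" 1]
        label_of_inner(2)[of x y] assms by (simp add: defs)
  next
    case (5 x' y')
    then have "x' = x + 1" "y' = y - 1" using that by (simp_all add: defs)
    with 5 show ?thesis using lab[of "hor x y" 0] lab[of "fall x (y - 1)" 1]
        label_of_inner(3)[of x' y'] assms by (simp add: defs)
  next
    case (6 x' y')
    then have "x' = x" "y' = y - 1" using that by (simp_all add: defs)
    with 6 show ?thesis using lab[of "hor x y" 1] lab[of "rise (x + 1) (y - 1)" 0]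
        label_of_inner(4)[of x' y'] assms by (simp add: defs)
  qed
qed

lemma puzzle_of_label_of: "puzzle_of n (label_of P) = P"
proof (intro equalityI subsetI)
  fix p assume p: "p \<in> P"
  then have "p \<in> ordinary_pieces \<union> equivariant_pieces" by (rule pieces)
  then have "fst p \<noteq> {}"
    by (cases p rule: piece_cases) (simp_all add: piece_defs)
  then obtain c where c: "c \<in> fst p" by blast
  have c_in: "c \<in> cells_of_triangle n" using p c by (rule cells)
  then show "p \<in> puzzle_of n (label_of P)"
  proof (cases rule: cell_cases)
    case (1 x y)
    then show ?thesis
      using labels_of_piece(1)[OF p, of x y] c c_in puzzle_ofI(1)[of x y n "label_of P"] by simp
  next
    case (2 x y)
    then show ?thesis
      using labels_of_piece(2)[OF p, of x y] c c_in puzzle_ofI(2)[of x y n "label_of P"] by simp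
  qed
next
  fix p assume "p \<in> puzzle_of n (label_of P)"
  then show "p \<in> P"
  proof (cases rule: puzzle_ofE)
    case (1 x y)
    obtain q where "q \<in> P" "up x y \<in> fst q" using 1(1) by (rule covering_piece)
    then show ?thesis using labels_of_piece(1)[of q x y] 1(2) by simp
  next
    case (2 x y)
    obtain q where "q \<in> P" "down x y \<in> fst q" using 2(1) by (rule covering_piece)
    then show ?thesis using labels_of_piece(2)[of q x y] 2(2) by simp
  qed
qed

lemma admissible_label_of:
  "up x y \<in> cells_of_triangle n \<Longrightarrow> admissible_up (label_of P) x y"
  "down x y \<in> cells_of_triangle n \<Longrightarrow> admissible_down (label_of P) x y"
  by (meson covering_piece labels_of_piece(1)) (meson covering_piece labels_of_piece(2))

end

lemma valid_labelingD:
  assumes "valid_labeling n L"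
  shows "up x y \<in> cells_of_triangle n \<Longrightarrow> admissible_up L x y"
    and "down x y \<in> cells_of_triangle n \<Longrightarrow> admissible_down L x y"
    and "i < n \<Longrightarrow> L (rise 0 (int i)) \<le> 1"
    and "i < n \<Longrightarrow> L (fall (int i) (int n - 1 - int i)) \<le> 1"
    and "i < n \<Longrightarrow> L (hor (int i) 0) \<le> 1"
  using assms unfolding valid_labeling_def by simp_all

lemma admissible_cases:
  assumes "admissible a b h"
  obtains "a = 0" "b = 0" "h = 0" | "a = 1" "b = 1" "h = 1" | "a = 1" "b = 0" "h = 2"
    | "a = 2" "b = 1" "h = 0" | "a = 0" "b = 2" "h = 1" | "a = 0" "b = 1" "h = 3"
  using assms unfolding admissible_def by auto

text \<open>
  A label 2 or 3 announces a rhombus that extends across the edge. It stays inside the big triangle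
  because the sides of the triangle have labels 0 and 1 only.
\<close>
lemma cell_across_inner_edge:
  assumes "valid_labeling n L"
  shows "up x y \<in> cells_of_triangle n \<Longrightarrow> 2 \<le> L (hor x y) \<Longrightarrow> down x y \<in> cells_of_triangle n"
    and "up x y \<in> cells_of_triangle n \<Longrightarrow> 2 \<le> L (rise x y) \<Longrightarrow>
      down (x - 1) (y + 1) \<in> cells_of_triangle n"
    and "up x y \<in> cells_of_triangle n \<Longrightarrow> 2 \<le> L (fall x y) \<Longrightarrow>
      down x (y + 1) \<in> cells_of_triangle n"
    and "down x y \<in> cells_of_triangle n \<Longrightarrow> up x y \<in> cells_of_triangle n"
    and "down x y \<in> cells_of_triangle n \<Longrightarrow> up (x + 1) (y - 1) \<in> cells_of_triangle n"
    and "down x y \<in> cells_of_triangle n \<Longrightarrow> up x (y - 1) \<in> cells_of_triangle n"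
proof -
  show "down x y \<in> cells_of_triangle n" if "up x y \<in> cells_of_triangle n" "2 \<le> L (hor x y)"
    using that valid_labelingD(5)[OF assms, of "nat x"]
    unfolding up_in_triangle down_in_triangle by (cases "y = 0") (auto simp: nat_less_iff)
  show "down (x - 1) (y + 1) \<in> cells_of_triangle n"
    if "up x y \<in> cells_of_triangle n" "2 \<le> L (rise x y)"
    using that valid_labelingD(3)[OF assms, of "nat y"]
    unfolding up_in_triangle down_in_triangle by (cases "x = 0") (auto simp: nat_less_iff)
  show "down x (y + 1) \<in> cells_of_triangle n"
    if "up x y \<in> cells_of_triangle n" "2 \<le> L (fall x y)"
  proof (cases "x + y = int n - 1")
    case True
    then have "y = int n - 1 - x" by simp
    then show ?thesis using that valid_labelingD(4)[OF assms, of "nat x"]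
      unfolding up_in_triangle by (simp add: nat_less_iff)
  next
    case False
    then show ?thesis using that unfolding up_in_triangle down_in_triangle by simp
  qed
qed (simp_all add: up_in_triangle down_in_triangle)

context
  fixes n L
  assumes valid: "valid_labeling n L"
begin

text \<open>
  The last claim makes the assignment of pieces to cells consistent: the two halves of a rhombus
  share the label of the cut, and this label alone forces the rhombus.
\<close>
lemma piece_at_up_cells:
  assumes "up x y \<in> cells_of_triangle n"
  shows "piece_at_up L x y \<in> ordinary_pieces \<union> equivariant_pieces"
    and "up x y \<in> fst (piece_at_up L x y)"
    and "up x' y' \<in> fst (piece_at_up L x y) \<Longrightarrow> x' = x \<and> y' = y"
    and "down x' y' \<in> fst (piece_at_up L x y) \<Longrightarrow>
      down x' y' \<in> cells_of_triangle n \<and> piece_at_down L x' y' = piece_at_up L x y"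
proof -
  note adm = valid_labelingD(1)[OF valid assms, unfolded admissible_up_def]
  have eqv: "rhombus_hor 1 0 x y \<in> equivariant_pieces"
    unfolding equivariant_pieces_eq by blast
  show "piece_at_up L x y \<in> ordinary_pieces \<union> equivariant_pieces"
    using adm by (cases rule: admissible_cases)
      (simp_all add: piece_at_up_def ordinary_piecesI eqv del: One_nat_def)
  show "up x y \<in> fst (piece_at_up L x y)"
    using adm by (cases rule: admissible_cases) (simp_all add: piece_at_up_def piece_defs)
  show "x' = x \<and> y' = y" if "up x' y' \<in> fst (piece_at_up L x y)"
    using adm that by (cases rule: admissible_cases) (simp_all add: piece_at_up_def piece_defs)
  show "down x' y' \<in> cells_of_triangle n \<and> piece_at_down L x' y' = piece_at_up L x y"
    if d: "down x' y' \<in> fst (piece_at_up L x y)"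
    using adm
  proof (cases rule: admissible_cases)
    case 3
    then have "x' = x" "y' = y" "down x y \<in> cells_of_triangle n"
      using d cell_across_inner_edge(1)[OF valid assms] by (simp_all add: piece_at_up_def piece_defs)
    then show ?thesis using 3 by (simp add: piece_at_up_def piece_at_down_def)
  next
    case 4
    then have *: "x' = x - 1" "y' = y + 1" "down x' y' \<in> cells_of_triangle n"
      using d cell_across_inner_edge(2)[OF valid assms] by (simp_all add: piece_at_up_def piece_defs)
    then have "admissible 2 (L (fall x' y)) (L (hor x' y'))"
      using valid_labelingD(2)[OF valid *(3)] 4 unfolding admissible_down_def by simp
    then show ?thesis using 4 * by (auto simp: piece_at_up_def piece_at_down_def admissible_def)
  next
    case 5
    then have *: "x' = x" "y' = y + 1" "down x' y' \<in> cells_of_triangle n"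
      using d cell_across_inner_edge(3)[OF valid assms] by (simp_all add: piece_at_up_def piece_defs)
    then have "admissible (L (rise (x + 1) y)) 2 (L (hor x' y'))"
      using valid_labelingD(2)[OF valid *(3)] 5 unfolding admissible_down_def by simp
    then show ?thesis using 5 * by (auto simp: piece_at_up_def piece_at_down_def admissible_def)
  next
    case 6
    then have "x' = x" "y' = y" "down x y \<in> cells_of_triangle n"
      using d cell_across_inner_edge(1)[OF valid assms] by (simp_all add: piece_at_up_def piece_defs)
    then show ?thesis using 6 by (simp add: piece_at_up_def piece_at_down_def)
  qed (use d in \<open>simp_all add: piece_at_up_def piece_defs\<close>)
qed

text \<open>
  Every rhombus contains an up cell. So down triangles are the only pieces that have to be treated
  apart from those over up cells.
\<close>
lemma piece_at_down_cases:
  assumes "down x y \<in> cells_of_triangle n"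
  obtains l where "l \<le> 1" "piece_at_down L x y = down_triangle l x y"
      "L (hor x y) = l" "L (rise (x + 1) (y - 1)) = l" "L (fall x (y - 1)) = l"
    | x' y' where "up x' y' \<in> cells_of_triangle n" "piece_at_down L x y = piece_at_up L x' y'"
      "down x y \<in> fst (piece_at_up L x' y')"
proof -
  note adm = valid_labelingD(2)[OF valid assms, unfolded admissible_down_def]
  note nb = cell_across_inner_edge(4-6)[OF valid assms]
  show thesis
    using adm
  proof (cases rule: admissible_cases)
    case 1 then show thesis by (intro that(1)[of 0]) (simp_all add: piece_at_down_def)
  next
    case 2 then show thesis by (intro that(1)[of 1]) (simp_all add: piece_at_down_def)
  next
    case 3 then show thesis using nb
      by (intro that(2)[of x y]) (simp_all add: piece_at_down_def piece_at_up_def piece_defs)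
  next
    case 6 then show thesis using nb
      by (intro that(2)[of x y]) (simp_all add: piece_at_down_def piece_at_up_def piece_defs)
  next
    case 4
    have "admissible 2 (L (fall (x + 1) (y - 1))) (L (hor (x + 1) (y - 1)))"
      using valid_labelingD(1)[OF valid nb(2)] 4 unfolding admissible_up_def by simp
    then have "L (fall (x + 1) (y - 1)) = 1" "L (hor (x + 1) (y - 1)) = 0"
      by (auto simp: admissible_def)
    then show thesis using 4 nb
      by (intro that(2)[of "x + 1" "y - 1"]) (simp_all add: piece_at_down_def piece_at_up_def piece_defs)
  next
    case 5
    have "admissible (L (rise x (y - 1))) 2 (L (hor x (y - 1)))"
      using valid_labelingD(1)[OF valid nb(3)] 5 unfolding admissible_up_def by simp
    then have "L (rise x (y - 1)) = 0" "L (hor x (y - 1)) = 1"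
      by (auto simp: admissible_def)
    then show thesis using 5 nb
      by (intro that(2)[of x "y - 1"]) (simp_all add: piece_at_down_def piece_at_up_def piece_defs)
  qed
qed

lemma piece_at_down_cell:
  assumes "down x y \<in> cells_of_triangle n"
  shows "down x y \<in> fst (piece_at_down L x y)"
  using assms by (cases rule: piece_at_down_cases) (simp_all add: piece_defs)

lemma puzzle_of_piece_cases:
  assumes "p \<in> puzzle_of n L"
  obtains x y where "up x y \<in> cells_of_triangle n" "p = piece_at_up L x y"
    | l x y where "down x y \<in> cells_of_triangle n" "l \<le> 1" "p = piece_at_down L x y"
      "p = down_triangle l x y"
      "L (hor x y) = l" "L (rise (x + 1) (y - 1)) = l" "L (fall x (y - 1)) = l"
  using assms
proof (cases rule: puzzle_ofE)
  case (1 x y) then show ?thesis by (rule that(1))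
next
  case (2 x y)
  note down = 2
  from down(1) show ?thesis
  proof (cases rule: piece_at_down_cases)
    case (1 l) then show ?thesis by (intro that(2)[of x y l]) (use down in simp_all)
  next
    case (2 x' y') then show ?thesis by (intro that(1)[of x' y']) (use down in simp_all)
  qed
qed

lemma piece_of_cell:
  assumes "p \<in> puzzle_of n L"
  shows "up x y \<in> fst p \<Longrightarrow> up x y \<in> cells_of_triangle n \<and> p = piece_at_up L x y"
    and "down x y \<in> fst p \<Longrightarrow> down x y \<in> cells_of_triangle n \<and> p = piece_at_down L x y"
proof -
  show "up x y \<in> cells_of_triangle n \<and> p = piece_at_up L x y" if "up x y \<in> fst p"
    using assms
  proof (cases rule: puzzle_of_piece_cases)
    case (1 x' y')
    then show ?thesis using that piece_at_up_cells(3)[of x' y' x y] by simp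
  next
    case (2 l x' y')
    show ?thesis using that unfolding 2(4) by (simp add: down_triangle_def)
  qed
  show "down x y \<in> cells_of_triangle n \<and> p = piece_at_down L x y" if "down x y \<in> fst p"
    using assms
  proof (cases rule: puzzle_of_piece_cases)
    case (1 x' y')
    then show ?thesis using that piece_at_up_cells(4)[of x' y' x y] by simp
  next
    case (2 l x' y')
    have "x = x'" "y = y'" using that unfolding 2(4) by (simp_all add: down_triangle_def)
    then show ?thesis using 2 by simp
  qed
qed

lemma puzzle_of_labels:
  assumes "p \<in> puzzle_of n L" "(e, l) \<in> snd p"
  shows "L e = l"
  using assms(1)
proof (cases rule: puzzle_of_piece_cases)
  case (2 l' x y)
  show ?thesis using assms(2) 2(5-) unfolding 2(4) down_triangle_def by auto
next
  case (1 x y)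
  note adm = valid_labelingD(1)[OF valid 1(1), unfolded admissible_up_def]
  note e = assms(2)[unfolded 1(2) piece_at_up_def]
  note down = valid_labelingD(2)[OF valid, unfolded admissible_down_def]
  from adm show ?thesis
  proof (cases rule: admissible_cases)
    case 3
    then have "admissible (L (rise (x + 1) (y - 1))) (L (fall x (y - 1))) 2"
      using down[of x y] cell_across_inner_edge(1)[OF valid 1(1)] by simp
    then show ?thesis using 3 e by (auto simp: admissible_def piece_defs)
  next
    case 4
    then have "admissible 2 (L (fall (x - 1) y)) (L (hor (x - 1) (y + 1)))"
      using down[of "x - 1" "y + 1"] cell_across_inner_edge(2)[OF valid 1(1)] by simp
    then show ?thesis using 4 e by (auto simp: admissible_def piece_defs)
  next
    case 5
    then have "admissible (L (rise (x + 1) y)) 2 (L (hor x (y + 1)))"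
      using down[of x "y + 1"] cell_across_inner_edge(3)[OF valid 1(1)] by simp
    then show ?thesis using 5 e by (auto simp: admissible_def piece_defs)
  next
    case 6
    then have "admissible (L (rise (x + 1) (y - 1))) (L (fall x (y - 1))) 3"
      using down[of x y] cell_across_inner_edge(1)[OF valid 1(1)] by simp
    then show ?thesis using 6 e by (auto simp: admissible_def piece_defs)
  qed (use e in \<open>auto simp: piece_defs\<close>)
qed

lemma is_tiling_puzzle_of: "is_tiling n (puzzle_of n L)"
  unfolding is_tiling_def
proof (intro conjI ballI impI allI)
  show "puzzle_of n L \<subseteq> ordinary_pieces \<union> equivariant_pieces"
  proof
    fix p assume "p \<in> puzzle_of n L"
    then show "p \<in> ordinary_pieces \<union> equivariant_pieces"
    proof (cases rule: puzzle_of_piece_cases)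
      case (1 x y) then show ?thesis using piece_at_up_cells(1)[of x y] by simp
    next
      case (2 l x y) then show ?thesis using ordinary_piecesI(2)[of l x y] by simp
    qed
  qed
  have cell: "c \<in> cells_of_triangle n" if "p \<in> puzzle_of n L" "c \<in> fst p" for p c
  proof -
    have "\<exists>x y. c = up x y \<or> c = down x y"
      using that(1)
    proof (cases rule: puzzle_of_piece_cases)
      case (1 x y)
      from valid_labelingD(1)[OF valid 1(1), unfolded admissible_up_def] that(2) 1(2)
      show ?thesis by (cases rule: admissible_cases) (auto simp: piece_at_up_def piece_defs)
    next
      case (2 l x y)
      show ?thesis using that(2) unfolding 2(4) down_triangle_def by auto
    qed
    then show ?thesis using piece_of_cell[OF that(1)] that(2) by metis
  qed
  show "fst p \<inter> fst q = {}" if "p \<in> puzzle_of n L" "q \<in> puzzle_of n L" "p \<noteq> q" for p q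
  proof (rule ccontr)
    assume "fst p \<inter> fst q \<noteq> {}"
    then obtain c where c: "c \<in> fst p" "c \<in> fst q" by blast
    from cell[OF that(1) c(1)] show False
    proof (cases rule: cell_cases)
      case (1 x y)
      then show False
        using c that(3) piece_of_cell(1)[OF that(1), of x y] piece_of_cell(1)[OF that(2), of x y]
        by simp
    next
      case (2 x y)
      then show False
        using c that(3) piece_of_cell(2)[OF that(1), of x y] piece_of_cell(2)[OF that(2), of x y]
        by simp
    qed
  qed
  show "(\<Union>p\<in>puzzle_of n L. fst p) = cells_of_triangle n"
  proof (intro equalityI subsetI)
    fix c assume c: "c \<in> cells_of_triangle n"
    then show "c \<in> (\<Union>p\<in>puzzle_of n L. fst p)"
    proof (cases rule: cell_cases)
      case (1 x y)
      then show ?thesis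
        using c puzzle_ofI(1)[of x y n L] piece_at_up_cells(2)[of x y] by blast
    next
      case (2 x y)
      then show ?thesis
        using c puzzle_ofI(2)[of x y n L] piece_at_down_cell[of x y] by blast
    qed
  next
    fix c assume "c \<in> (\<Union>p\<in>puzzle_of n L. fst p)"
    then obtain p where "p \<in> puzzle_of n L" "c \<in> fst p" by blast
    then show "c \<in> cells_of_triangle n" by (rule cell)
  qed
  show "l = l'" if "p \<in> puzzle_of n L" "q \<in> puzzle_of n L" "(e, l) \<in> snd p \<and> (e, l') \<in> snd q"
    for p q e l l'
    using puzzle_of_labels[OF that(1), of e l] puzzle_of_labels[OF that(2), of e l'] that(3) by simp
qed

lemma labeled_by_puzzle_of:
  assumes "up x y \<in> cells_of_triangle n"
  shows "L (rise x y) \<le> 1 \<Longrightarrow> labeled_by (puzzle_of n L) (rise x y) (L (rise x y))"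
    and "L (fall x y) \<le> 1 \<Longrightarrow> labeled_by (puzzle_of n L) (fall x y) (L (fall x y))"
    and "L (hor x y) \<le> 1 \<Longrightarrow> labeled_by (puzzle_of n L) (hor x y) (L (hor x y))"
proof -
  note adm = valid_labelingD(1)[OF valid assms, unfolded admissible_up_def]
  have *: "labeled_by (puzzle_of n L) e l" if "(e, l) \<in> snd (piece_at_up L x y)" for e l
    using that puzzle_ofI(1)[OF assms] unfolding labeled_by_def by blast
  show "labeled_by (puzzle_of n L) (rise x y) (L (rise x y))" if "L (rise x y) \<le> 1"
    using adm by (intro *, cases rule: admissible_cases)
      (use that in \<open>simp_all add: piece_at_up_def piece_defs\<close>)
  show "labeled_by (puzzle_of n L) (fall x y) (L (fall x y))" if "L (fall x y) \<le> 1"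
    using adm by (intro *, cases rule: admissible_cases)
      (use that in \<open>simp_all add: piece_at_up_def piece_defs\<close>)
  show "labeled_by (puzzle_of n L) (hor x y) (L (hor x y))" if "L (hor x y) \<le> 1"
    using adm by (intro *, cases rule: admissible_cases)
      (use that in \<open>simp_all add: piece_at_up_def piece_defs\<close>)
qed

text \<open>The labeling can be recovered from the puzzle, since every edge of the big triangle belongs to an up cell.\<close>
lemma label_of_puzzle_of:
  assumes "up x y \<in> cells_of_triangle n"
  shows "label_of (puzzle_of n L) (rise x y) = L (rise x y)"
    and "label_of (puzzle_of n L) (fall x y) = L (fall x y)"
    and "label_of (puzzle_of n L) (hor x y) = L (hor x y)"
proof -
  let ?P = "puzzle_of n L"
  note adm = valid_labelingD(1)[OF valid assms, unfolded admissible_up_def]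
  have P: "piece_at_up L x y \<in> ?P" using assms by (rule puzzle_ofI)
  note inner = label_of_inner[OF is_tiling_puzzle_of, of x y]
  have lab: "label_of ?P e = l" if "labeled_by ?P e l" for e l
    using that label_of_labeled[OF is_tiling_puzzle_of] unfolding labeled_by_def by blast
  note outer = labeled_by_puzzle_of[OF assms, THEN lab]
  show "label_of ?P (rise x y) = L (rise x y)"
    using adm by (cases rule: admissible_cases) (use P inner outer in \<open>simp_all add: piece_at_up_def\<close>)
  show "label_of ?P (fall x y) = L (fall x y)"
    using adm by (cases rule: admissible_cases) (use P inner outer in \<open>simp_all add: piece_at_up_def\<close>)
  show "label_of ?P (hor x y) = L (hor x y)"
    using adm by (cases rule: admissible_cases) (use P inner outer in \<open>simp_all add: piece_at_up_def\<close>)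
qed

end

lemma puzzle_of_cong:
  assumes "\<And>x y. up x y \<in> cells_of_triangle n \<Longrightarrow>
    L (rise x y) = L' (rise x y) \<and> L (fall x y) = L' (fall x y) \<and> L (hor x y) = L' (hor x y)"
  shows "puzzle_of n L = puzzle_of n L'"
proof -
  have up: "piece_at_up L x y = piece_at_up L' x y" if "up x y \<in> cells_of_triangle n" for x y
    using assms[OF that] unfolding piece_at_up_def by simp
  have down: "piece_at_down L x y = piece_at_down L' x y"
    if "down x y \<in> cells_of_triangle n" for x y
    using that assms[of x y] assms[of "x + 1" "y - 1"] assms[of x "y - 1"]
    unfolding piece_at_down_def up_in_triangle down_in_triangle by simp
  show ?thesis
  proof (intro equalityI subsetI)
    fix p assume "p \<in> puzzle_of n L"
    then show "p \<in> puzzle_of n L'"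
      by (cases rule: puzzle_ofE) (simp_all add: up down puzzle_ofI)
  next
    fix p assume "p \<in> puzzle_of n L'"
    then show "p \<in> puzzle_of n L"
      by (cases rule: puzzle_ofE) (simp_all add: up [symmetric] down [symmetric] puzzle_ofI)
  qed
qed

section \<open>Boundary words\<close>
definition zeros :: "(nat \<Rightarrow> nat) \<Rightarrow> nat \<Rightarrow> nat" where
  "zeros f x = (\<Sum>i<x. of_bool (f i = 0))"

text \<open>
  Words are continued by ones. With this convention a strip whose ends have label 1 does not change
  the word at all, and counts of zeros are defined at all positions.
\<close>
definition letter :: "nat list \<Rightarrow> nat \<Rightarrow> nat" where
  "letter w i = (if i < length w then w ! i else 1)"

lemma zeros_0 [simp]: "zeros f 0 = 0"
  by (simp add: zeros_def)

lemma zeros_Suc [simp]: "zeros f (Suc x) = zeros f x + of_bool (f x = 0)"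
  by (simp add: zeros_def)

lemma zeros_mono: "x \<le> y \<Longrightarrow> zeros f x \<le> zeros f y"
  unfolding zeros_def by (intro sum_mono2) auto

lemma zeros_eq_card: "zeros f x = card {i. i < x \<and> f i = 0}"
proof -
  have "{i. i < x \<and> f i = 0} = {..<x} \<inter> {i. f i = 0}" by auto
  then show ?thesis unfolding zeros_def by (simp add: sum_of_bool_eq)
qed

lemma zeros_at_positions:
  fixes pos :: "nat \<Rightarrow> nat"
  assumes pos: "strict_mono_on {..<a} pos" and f: "\<And>x. f x = 0 \<longleftrightarrow> (\<exists>q<a. x = pos q)"
    and "q < a"
  shows "zeros f x \<le> q \<longleftrightarrow> x \<le> pos q"
proof -
  have less_iff: "pos q < pos q' \<longleftrightarrow> q < q'" if "q < a" "q' < a" for q q'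
    using that strict_mono_on_less[OF pos] by simp
  note zeros_eq_card
  also have "{i. i < x \<and> f i = 0} = pos ` {q. q < a \<and> pos q < x}"
    unfolding f by auto
  also have "card \<dots> = card {q. q < a \<and> pos q < x}"
  proof (rule card_image)
    show "inj_on pos {q. q < a \<and> pos q < x}"
      using strict_mono_on_imp_inj_on[OF pos] by (rule inj_on_subset) auto
  qed
  finally have z: "zeros f x = card {q. q < a \<and> pos q < x}" .
  show ?thesis
  proof
    assume "x \<le> pos q"
    have "{q. q < a \<and> pos q < x} \<subseteq> {..<q}"
    proof clarify
      fix q' assume "q' < a" "pos q' < x"
      then have "pos q' < pos q" using \<open>x \<le> pos q\<close> by simp
      then show "q' < q" using less_iff[OF \<open>q' < a\<close> \<open>q < a\<close>] by simp
    qed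
    from card_mono[OF _ this] show "zeros f x \<le> q" unfolding z by simp
  next
    assume le: "zeros f x \<le> q"
    show "x \<le> pos q"
    proof (rule ccontr)
      assume "\<not> x \<le> pos q"
      have "{..q} \<subseteq> {q. q < a \<and> pos q < x}"
      proof
        fix q' assume "q' \<in> {..q}"
        then have "q' < a" "pos q' \<le> pos q"
          using \<open>q < a\<close> less_iff[of q' q] by (cases "q' = q"; simp)+
        then show "q' \<in> {q. q < a \<and> pos q < x}" using \<open>\<not> x \<le> pos q\<close> by simp
      qed
      from card_mono[OF _ this] show False using le unfolding z by simp
    qed
  qed
qed

lemma part_antimono:
  assumes "is_partition \<nu>" "1 \<le> i" "i \<le> j"
  shows "part \<nu> j \<le> part \<nu> i"
proof (cases "i < j \<and> j \<le> length \<nu>")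
  case True
  then have "\<nu> ! (j - 1) \<le> \<nu> ! (i - 1)"
    using assms unfolding is_partition_def by (intro sorted_wrt_nth_less[of "(\<ge>)"]) auto
  then show ?thesis using True assms by (simp add: part_def)
next
  case False then show ?thesis using assms by (cases "i = j") (auto simp: part_def)
qed

text \<open>
  The rows are written from the last to the first, so after \<open>q\<close> rows the path is at the end of row
  \<open>a + 1 - q\<close>. It has made \<open>q\<close> vertical steps and as many horizontal ones as this row has cells,
  and the next zero follows when the horizontal steps reach the length of row \<open>a - q\<close>.
\<close>
lemma boundary_word_rows:
  assumes "is_partition \<nu>" "length \<nu> \<le> a" "q \<le> a"
    and w: "w = concat (map (\<lambda>i. replicate (part \<nu> i - part \<nu> (i + 1)) 1 @ [0]) (rev [a + 1 - q..<a + 1]))"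
  shows "length w = part \<nu> (a + 1 - q) + q \<and> set w \<subseteq> {0, 1} \<and>
    (\<forall>x<length w. w ! x = (0::nat) \<longleftrightarrow> (\<exists>q'<q. x = part \<nu> (a - q') + q'))"
  using assms(3) w
proof (induction q arbitrary: w)
  case 0
  then show ?case using assms(2) by (simp add: part_def)
next
  case (Suc q)
  define v where "v = concat (map (\<lambda>i. replicate (part \<nu> i - part \<nu> (i + 1)) 1 @ [0::nat])
    (rev [a + 1 - q..<a + 1]))"
  let ?r = "part \<nu> (a - q) - part \<nu> (a + 1 - q)"
  have "[a + 1 - Suc q..<a + 1] = (a - q) # [a + 1 - q..<a + 1]"
    using Suc.prems(1) by (subst upt_conv_Cons) (auto simp: Suc_diff_le)
  then have w: "w = v @ replicate ?r 1 @ [0]"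
    unfolding Suc.prems(2) v_def using Suc.prems(1) by (simp add: Suc_diff_le)
  have le: "part \<nu> (a + 1 - q) \<le> part \<nu> (a - q)"
    using Suc.prems by (intro part_antimono assms) auto
  note IH = Suc.IH[OF _ v_def]
  have len: "length v = part \<nu> (a + 1 - q) + q" using IH Suc.prems(1) by simp
  have lw: "length w = part \<nu> (a - q) + Suc q"
    unfolding w using len le by simp
  have "w ! x = 0 \<longleftrightarrow> (\<exists>q'<Suc q. x = part \<nu> (a - q') + q')" if x: "x < length w" for x
  proof -
    have small: "part \<nu> (a - q') + q' < length v" if "q' < q" for q'
    proof -
      have "part \<nu> (a - q') \<le> part \<nu> (a + 1 - q)"
        using that Suc.prems by (intro part_antimono assms) auto
      then show ?thesis using that len by simp
    qed
    consider "x < length v" | "length v \<le> x" "x < length v + ?r" | "x = length v + ?r"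
      using x unfolding w by fastforce
    then show ?thesis
    proof cases
      case 1
      then have "w ! x = 0 \<longleftrightarrow> (\<exists>q'<q. x = part \<nu> (a - q') + q')"
        using IH Suc.prems(1) unfolding w by (simp add: nth_append)
      moreover have "x \<noteq> part \<nu> (a - q) + q" using 1 len le by simp
      ultimately show ?thesis using less_Suc_eq by metis
    next
      case 2
      then have "w ! x = 1" unfolding w by (simp add: nth_append)
      moreover have "x \<noteq> part \<nu> (a - q') + q'" if "q' < Suc q" for q'
        using that 2 small[of q'] len le by (cases "q' = q") auto
      ultimately show ?thesis by auto
    next
      case 3
      then have "w ! x = 0" unfolding w by (simp add: nth_append)
      moreover have "x = part \<nu> (a - q) + q" using 3 len le by simp
      ultimately show ?thesis by blast
    qed
  qed
  moreover have "set w \<subseteq> {0, 1}" using IH Suc.prems(1) unfolding w by auto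
  ultimately show ?case using lw Suc.prems(1) by simp
qed

lemma
  assumes "is_partition \<nu>" "fits_in_box a b \<nu>"
  shows length_boundary_word: "length (boundary_word a b \<nu>) = a + b"
    and letter_boundary_word_le: "letter (boundary_word a b \<nu>) x \<le> 1"
    and letter_boundary_word_eq_0: "letter (boundary_word a b \<nu>) x = 0 \<longleftrightarrow>
      (\<exists>q<a. x = part \<nu> (a - q) + q)"
proof -
  define v where "v = concat (map (\<lambda>i. replicate (part \<nu> i - part \<nu> (i + 1)) 1 @ [0::nat])
    (rev [a + 1 - a..<a + 1]))"
  have box: "length \<nu> \<le> a" "part \<nu> 1 \<le> b" using assms(2) unfolding fits_in_box_def by auto
  have v: "length v = part \<nu> 1 + a" "set v \<subseteq> {0, 1}"
    "x < length v \<Longrightarrow> v ! x = 0 \<longleftrightarrow> (\<exists>q<a. x = part \<nu> (a - q) + q)" for x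
    using boundary_word_rows[OF assms(1) box(1) order.refl v_def] by simp_all
  have w: "boundary_word a b \<nu> = v @ replicate (b - part \<nu> 1) 1"
    unfolding boundary_word_def v_def by simp
  show len: "length (boundary_word a b \<nu>) = a + b" unfolding w using v(1) box by simp
  have "set (boundary_word a b \<nu>) \<subseteq> {0, 1}" unfolding w using v(2) by auto
  then show "letter (boundary_word a b \<nu>) x \<le> 1"
    unfolding letter_def by (auto dest!: nth_mem)
  show "letter (boundary_word a b \<nu>) x = 0 \<longleftrightarrow> (\<exists>q<a. x = part \<nu> (a - q) + q)"
  proof (cases "x < length v")
    case True
    then show ?thesis using v(3) unfolding letter_def w by (simp add: nth_append)
  next
    case False
    then have "letter (boundary_word a b \<nu>) x = 1"
      unfolding letter_def w by (simp add: nth_append)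
    moreover have "x \<noteq> part \<nu> (a - q) + q" if "q < a" for q
    proof -
      have "part \<nu> (a - q) \<le> part \<nu> 1"
        using that by (intro part_antimono assms) auto
      then show ?thesis using that False v(1) by simp
    qed
    ultimately show ?thesis by auto
  qed
qed

text \<open>Hence a zero belonging to row \<open>a - q\<close> is preceded by exactly \<open>q\<close> zeros.\<close>
lemma zeros_boundary_word:
  assumes "is_partition \<nu>" "fits_in_box a b \<nu>" "q < a"
  shows "zeros (letter (boundary_word a b \<nu>)) x \<le> q \<longleftrightarrow> x \<le> part \<nu> (a - q) + q"
proof (rule zeros_at_positions[where a = a])
  show "strict_mono_on {..<a} (\<lambda>q. part \<nu> (a - q) + q)"
  proof (rule strict_mono_onI)
    fix q q' assume "q \<in> {..<a}" "q' \<in> {..<a}" "q < q'"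
    then have "part \<nu> (a - q) \<le> part \<nu> (a - q')"
      by (intro part_antimono assms) auto
    then show "part \<nu> (a - q) + q < part \<nu> (a - q') + q'" using \<open>q < q'\<close> by simp
  qed
qed (use assms letter_boundary_word_eq_0[OF assms(1,2)] in auto)

lemma zeros_boundary_word_le:
  assumes "is_partition \<nu>" "fits_in_box a b \<nu>"
  shows "zeros (letter (boundary_word a b \<nu>)) x \<le> a"
    and "a + b \<le> x \<Longrightarrow> zeros (letter (boundary_word a b \<nu>)) x = a"
proof -
  let ?f = "letter (boundary_word a b \<nu>)"
  note c = zeros_eq_card[of ?f x]
  have "{i. i < x \<and> ?f i = 0} \<subseteq> (\<lambda>q. part \<nu> (a - q) + q) ` {..<a}"
    unfolding letter_boundary_word_eq_0[OF assms] by auto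
  from card_mono[OF _ this] card_image_le[of "{..<a}" "\<lambda>q. part \<nu> (a - q) + q"]
  show le: "zeros ?f x \<le> a" unfolding c by simp
  show "zeros ?f x = a" if "a + b \<le> x"
  proof (cases "a = 0")
    case False
    have "part \<nu> 1 \<le> b" using assms(2) unfolding fits_in_box_def by auto
    then have "\<not> x \<le> part \<nu> (a - (a - 1)) + (a - 1)" using that False by simp
    then show ?thesis using zeros_boundary_word[OF assms, of "a - 1" x] le False by simp
  qed (use le in simp)
qed

section \<open>Tableaux as arrays of zero counts\<close>

text \<open>
  For a diagram \<open>D\<close> with at most \<open>t\<close> rows this is the number of zeros among the first \<open>x\<close> letters of
  its boundary word. Row \<open>i\<close> ends within the first \<open>x\<close> letters if the diagonal on which the path
  arrives after \<open>x\<close> steps meets row \<open>i\<close> outside of \<open>D\<close>, and it meets row \<open>i\<close> in column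
  \<open>x + i - t\<close>. The truncated subtraction is harmless because of the condition \<open>t - i < x\<close>.
\<close>
definition diagonal_count :: "(nat \<times> nat) set \<Rightarrow> nat \<Rightarrow> nat \<Rightarrow> nat" where
  "diagonal_count D t x = card {i \<in> {1..t}. t - i < x \<and> (i, x + i - t) \<notin> D}"

lemma diagonal_count_le: "diagonal_count D t x \<le> t"
proof -
  have "diagonal_count D t x \<le> card {1..t}"
    unfolding diagonal_count_def by (intro card_mono) auto
  then show ?thesis by simp
qed

definition closed_diagram :: "(nat \<times> nat) set \<Rightarrow> bool" where
  "closed_diagram D \<longleftrightarrow> (\<forall>i j. 1 \<le> i \<longrightarrow> 1 \<le> j \<longrightarrow>
     ((i + 1, j) \<in> D \<longrightarrow> (i, j) \<in> D) \<and> ((i, j + 1) \<in> D \<longrightarrow> (i, j) \<in> D))"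

lemma closed_diagramD:
  assumes "closed_diagram D" "1 \<le> i" "1 \<le> j"
  shows "(Suc i, j) \<in> D \<Longrightarrow> (i, j) \<in> D" "(i, Suc j) \<in> D \<Longrightarrow> (i, j) \<in> D"
  using assms unfolding closed_diagram_def Suc_eq_plus1 by blast+

lemma closed_diagram_diag:
  assumes "closed_diagram D" "(i + k, j + k) \<in> D" "1 \<le> i" "1 \<le> j"
  shows "(i, j) \<in> D"
  using assms(2)
proof (induction k)
  case (Suc k)
  then have "(i + k, Suc (j + k)) \<in> D"
    using closed_diagramD(1)[OF assms(1), of "i + k" "Suc (j + k)"] assms(3) by simp
  then have "(i + k, j + k) \<in> D"
    using closed_diagramD(2)[OF assms(1), of "i + k" "j + k"] assms(3,4) by simp
  then show ?case by (rule Suc.IH)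
qed simp

text \<open>
  A diagonal leaves the diagram once and for all, so the counted rows are the last ones among
  \<open>1, \<dots>, t\<close>, and there are at most \<open>t - i\<close> of them if and only if row \<open>i\<close> is not counted. All further
  properties of the counts follow from this equivalence.
\<close>
lemma diagonal_count_le_iff:
  assumes D: "closed_diagram D" and i: "1 \<le> i" "i \<le> t"
  shows "diagonal_count D t x \<le> t - i \<longleftrightarrow> x \<le> t - i \<or> (i, x + i - t) \<in> D"
proof -
  define S where "S = {i \<in> {1..t}. t - i < x \<and> (i, x + i - t) \<notin> D}"
  have S: "i' \<in> S \<longleftrightarrow> 1 \<le> i' \<and> i' \<le> t \<and> t - i' < x \<and> (i', x + i' - t) \<notin> D" for i'
    unfolding S_def by auto
  have up: "i'' \<in> S" if i': "i' \<in> S" "i' \<le> i''" "i'' \<le> t" for i' i''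
  proof -
    have ar: "1 \<le> i'" "1 \<le> x + i' - t" "x + i' - t + (i'' - i') = x + i'' - t" "t - i' < x"
      using i' unfolding S by auto
    have "(i'', x + i'' - t) \<notin> D"
    proof
      assume "(i'', x + i'' - t) \<in> D"
      then have "(i', x + i' - t) \<in> D"
        using closed_diagram_diag[OF D, of i' "i'' - i'" "x + i' - t"] ar i'(2) by simp
      then show False using i'(1) unfolding S by simp
    qed
    then show ?thesis using ar i'(2,3) unfolding S by simp
  qed
  have S_sub: "S \<subseteq> {1..t}" unfolding S_def by blast
  have "finite S" using S_sub by (rule finite_subset) simp
  have "card S \<le> t - i \<longleftrightarrow> i \<notin> S"
  proof
    assume le: "card S \<le> t - i"
    show "i \<notin> S"
    proof
      assume "i \<in> S"
      then have "{i..t} \<subseteq> S" using up[OF \<open>i \<in> S\<close>] by (meson atLeastAtMost_iff subsetI)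
      from card_mono[OF \<open>finite S\<close> this] show False using le i by simp
    qed
  next
    assume "i \<notin> S"
    then have "i < i'" if "i' \<in> S" for i'
      using up[OF that, of i] i by (metis not_le)
    then have "S \<subseteq> {i + 1..t}" using S_sub by fastforce
    from card_mono[OF _ this] show "card S \<le> t - i" by simp
  qed
  then show ?thesis unfolding diagonal_count_def S_def [symmetric] S using i by auto
qed

text \<open>
  Numbers that are at most \<open>t\<close> are compared through the statements \<open>\<dots> \<le> t - i\<close>, which speak of the
  membership of cells in row \<open>i\<close>.
\<close>
lemma le_by_thresholds:
  fixes f g :: nat
  assumes "f \<le> t" "\<And>i. 1 \<le> i \<Longrightarrow> i \<le> t \<Longrightarrow> g \<le> t - i \<Longrightarrow> f \<le> t - i"
  shows "f \<le> g"
proof (cases "t \<le> g")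
  case False
  then show ?thesis using assms(2)[of "t - g"] by simp
qed (use assms(1) in simp)

lemma le_Suc_by_thresholds:
  fixes f g :: nat
  assumes "f \<le> t" "\<And>i. 1 \<le> i \<Longrightarrow> i < t \<Longrightarrow> g \<le> t - 1 - i \<Longrightarrow> f \<le> t - i"
  shows "f \<le> Suc g"
proof (cases "t \<le> Suc g")
  case False
  then show ?thesis using assms(2)[of "t - 1 - g"] by simp
qed (use assms(1) in simp)

lemma diagonal_count_0 [simp]: "diagonal_count D t 0 = 0"
  by (simp add: diagonal_count_def)

lemma diagonal_count_step:
  assumes D: "closed_diagram D"
  shows "diagonal_count D t x \<le> diagonal_count D t (Suc x)"
    and "diagonal_count D t (Suc x) \<le> Suc (diagonal_count D t x)"
proof -
  show "diagonal_count D t x \<le> diagonal_count D t (Suc x)"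
  proof (rule le_by_thresholds[OF diagonal_count_le])
    fix i assume i: "1 \<le> i" "i \<le> t" "diagonal_count D t (Suc x) \<le> t - i"
    then have "Suc x \<le> t - i \<or> (i, Suc x + i - t) \<in> D"
      using diagonal_count_le_iff[OF D i(1,2)] by blast
    then have "x \<le> t - i \<or> (i, x + i - t) \<in> D"
      using closed_diagramD(2)[OF D i(1), of "x + i - t"]
      by (cases "x \<le> t - i") (auto simp: Suc_diff_le)
    then show "diagonal_count D t x \<le> t - i" using diagonal_count_le_iff[OF D i(1,2)] by blast
  qed
  show "diagonal_count D t (Suc x) \<le> Suc (diagonal_count D t x)"
  proof (rule le_Suc_by_thresholds[OF diagonal_count_le])
    fix i assume i: "1 \<le> i" "i < t" "diagonal_count D t x \<le> t - 1 - i"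
    then have "x \<le> t - (i + 1) \<or> (i + 1, x + (i + 1) - t) \<in> D"
      using diagonal_count_le_iff[OF D, of "i + 1" t x] by simp
    then show "diagonal_count D t (Suc x) \<le> t - i"
      unfolding diagonal_count_le_iff[OF D i(1) less_imp_le[OF i(2)]]
    proof
      assume "x \<le> t - (i + 1)"
      then have "Suc x \<le> t - i" using i(2) by linarith
      then show "Suc x \<le> t - i \<or> (i, Suc x + i - t) \<in> D" ..
    next
      assume d: "(i + 1, x + (i + 1) - t) \<in> D"
      show "Suc x \<le> t - i \<or> (i, Suc x + i - t) \<in> D"
      proof (cases "Suc x \<le> t - i")
        case False
        then have "1 \<le> Suc x + i - t" using i by simp
        then show ?thesis using d closed_diagramD(1)[OF D i(1), of "Suc x + i - t"] by simp
      qed simp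
    qed
  qed
qed

text \<open>
  The word of \<open>E\<close> has one more zero than that of \<open>D\<close>, so the same diagonal of letters meets row
  \<open>i + 1\<close> of \<open>E\<close> and row \<open>i\<close> of \<open>D\<close> in the same column. The horizontal strip condition compares
  exactly these cells and yields the first inequality; \<open>D \<subseteq> E\<close> yields the second.
\<close>
lemma diagonal_count_interlace:
  assumes D: "closed_diagram D" and E: "closed_diagram E"
    and sub: "D \<subseteq> E" and hs: "\<And>i j. 1 \<le> i \<Longrightarrow> (i + 1, j) \<in> E \<Longrightarrow> (i, j) \<in> D"
  shows "diagonal_count D t x \<le> diagonal_count E (Suc t) x"
    and "diagonal_count E (Suc t) (Suc x) \<le> Suc (diagonal_count D t x)"
proof -
  show "diagonal_count D t x \<le> diagonal_count E (Suc t) x"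
  proof (rule le_by_thresholds[OF diagonal_count_le])
    fix i assume i: "1 \<le> i" "i \<le> t" "diagonal_count E (Suc t) x \<le> t - i"
    then have "x \<le> t - i \<or> (i + 1, x + (i + 1) - Suc t) \<in> E"
      using diagonal_count_le_iff[OF E, of "i + 1" "Suc t" x] by simp
    then have "x \<le> t - i \<or> (i, x + i - t) \<in> D" using hs[OF i(1)] by auto
    then show "diagonal_count D t x \<le> t - i" using diagonal_count_le_iff[OF D i(1,2)] by blast
  qed
  show "diagonal_count E (Suc t) (Suc x) \<le> Suc (diagonal_count D t x)"
  proof (rule le_Suc_by_thresholds[OF diagonal_count_le])
    fix i assume i: "1 \<le> i" "i < Suc t" "diagonal_count D t x \<le> Suc t - 1 - i"
    then have "x \<le> t - i \<or> (i, x + i - t) \<in> D"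
      using diagonal_count_le_iff[OF D, of i t x] by simp
    then have "Suc x \<le> Suc t - i \<or> (i, Suc x + i - Suc t) \<in> E" using sub i by auto
    then show "diagonal_count E (Suc t) (Suc x) \<le> Suc t - i"
      using diagonal_count_le_iff[OF E, of i "Suc t" "Suc x"] i by simp
  qed
qed

definition subtableau :: "nat list \<Rightarrow> (nat \<times> nat \<Rightarrow> nat) \<Rightarrow> nat \<Rightarrow> (nat \<times> nat) set" where
  "subtableau \<mu> T t = {u \<in> diagram \<mu>. T u \<le> t}"

lemma diagram_mono:
  assumes "is_partition \<mu>" "(i, j) \<in> diagram \<mu>" "1 \<le> i'" "i' \<le> i" "1 \<le> j'" "j' \<le> j"
  shows "(i', j') \<in> diagram \<mu>"
  using part_antimono[OF assms(1,3,4)] assms unfolding diagram_def by auto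

lemma SSYT_D:
  assumes "T \<in> SSYT \<mu> d"
  shows "(i, j) \<in> diagram \<mu> \<Longrightarrow> 1 \<le> T (i, j)" "(i, j) \<in> diagram \<mu> \<Longrightarrow> T (i, j) \<le> d"
    and "(i, j) \<in> diagram \<mu> \<Longrightarrow> (i, j + 1) \<in> diagram \<mu> \<Longrightarrow> T (i, j) \<le> T (i, j + 1)"
    and "(i, j) \<in> diagram \<mu> \<Longrightarrow> (i + 1, j) \<in> diagram \<mu> \<Longrightarrow> T (i, j) < T (i + 1, j)"
    and "u \<notin> diagram \<mu> \<Longrightarrow> T u = undefined"
proof -
  have T: "T \<in> diagram \<mu> \<rightarrow>\<^sub>E {1..d}" using assms unfolding SSYT_def by simp
  show "(i, j) \<in> diagram \<mu> \<Longrightarrow> 1 \<le> T (i, j)" "(i, j) \<in> diagram \<mu> \<Longrightarrow> T (i, j) \<le> d"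
    using PiE_mem[OF T] by fastforce+
  show "u \<notin> diagram \<mu> \<Longrightarrow> T u = undefined" using T by (rule PiE_arb)
qed (use assms in \<open>simp_all add: SSYT_def\<close>)

lemma subtableau_props:
  assumes \<mu>: "is_partition \<mu>" and T: "T \<in> SSYT \<mu> d"
  shows "closed_diagram (subtableau \<mu> T t)"
    and "subtableau \<mu> T t \<subseteq> subtableau \<mu> T (Suc t)"
    and "1 \<le> i \<Longrightarrow> (i + 1, j) \<in> subtableau \<mu> T (Suc t) \<Longrightarrow> (i, j) \<in> subtableau \<mu> T t"
    and "(i, j) \<in> diagram \<mu> \<Longrightarrow> i \<le> T (i, j)"
proof -
  have dm: "1 \<le> i" "1 \<le> j" if "(i, j) \<in> diagram \<mu>" for i j
    using that unfolding diagram_def by auto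
  have row: "(i, j) \<in> diagram \<mu> \<and> T (i, j) \<le> T (i, j + 1)"
    if "(i, j + 1) \<in> diagram \<mu>" "1 \<le> j" for i j
  proof -
    have "(i, j) \<in> diagram \<mu>" using diagram_mono[OF \<mu> that(1), of i j] dm[OF that(1)] that(2) by simp
    then show ?thesis using SSYT_D(3)[OF T] that by blast
  qed
  have col: "(i, j) \<in> diagram \<mu> \<and> T (i, j) < T (i + 1, j)"
    if "(i + 1, j) \<in> diagram \<mu>" "1 \<le> i" for i j
  proof -
    have "(i, j) \<in> diagram \<mu>" using diagram_mono[OF \<mu> that(1), of i j] dm[OF that(1)] that(2) by simp
    then show ?thesis using SSYT_D(4)[OF T] that by blast
  qed
  show "closed_diagram (subtableau \<mu> T t)"
    unfolding closed_diagram_def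
  proof (intro allI impI conjI)
    fix i j :: nat assume ij: "1 \<le> i" "1 \<le> j"
    show "(i, j) \<in> subtableau \<mu> T t" if "(i + 1, j) \<in> subtableau \<mu> T t"
      using col[of i j] that ij unfolding subtableau_def by simp
    show "(i, j) \<in> subtableau \<mu> T t" if "(i, j + 1) \<in> subtableau \<mu> T t"
      using row[of i j] that ij unfolding subtableau_def by simp
  qed
  show "subtableau \<mu> T t \<subseteq> subtableau \<mu> T (Suc t)" unfolding subtableau_def by auto
  show "(i, j) \<in> subtableau \<mu> T t" if "1 \<le> i" "(i + 1, j) \<in> subtableau \<mu> T (Suc t)"
    using col[of i j] that unfolding subtableau_def by simp
  show "i \<le> T (i, j)" if "(i, j) \<in> diagram \<mu>"
    using that
  proof (induction i)
    case (Suc i)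
    show ?case
    proof (cases "i = 0")
      case True then show ?thesis using SSYT_D(1)[OF T Suc.prems] by simp
    next
      case False
      then have "(i, j) \<in> diagram \<mu>" "T (i, j) < T (Suc i, j)" using col[of i j] Suc.prems by simp_all
      then show ?thesis using Suc.IH by simp
    qed
  qed simp
qed

text \<open>
  \<open>Z k x\<close> plays the role of the number of zeros among the first \<open>x\<close> letters on line \<open>k\<close>, where the
  strip between the lines \<open>s\<close> and \<open>s + 1\<close> has the label \<open>\<epsilon> s\<close> at its ends. The word on line \<open>k\<close> has
  as many zeros as \<open>\<epsilon>\<close> has before position \<open>k\<close>, all of them within the \<open>k\<close> letters of the line.
\<close>
definition zero_array :: "(nat \<Rightarrow> nat) \<Rightarrow> nat \<Rightarrow> (nat \<Rightarrow> nat \<Rightarrow> nat) \<Rightarrow> bool" where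
  "zero_array \<epsilon> n Z \<longleftrightarrow>
     (\<forall>k\<le>n. Z k 0 = 0 \<and> (\<forall>x. Z k x \<le> Z k (Suc x) \<and> Z k (Suc x) \<le> Suc (Z k x)) \<and>
        (\<forall>x\<ge>k. Z k x = zeros \<epsilon> k)) \<and>
     (\<forall>s<n. if \<epsilon> s = 0 then \<forall>x. Z s x \<le> Z (Suc s) x \<and> Z (Suc s) (Suc x) \<le> Suc (Z s x)
        else Z (Suc s) = Z s)"

lemma zero_arrayD:
  assumes "zero_array \<epsilon> n Z"
  shows "k \<le> n \<Longrightarrow> Z k 0 = 0"
    and "k \<le> n \<Longrightarrow> Z k x \<le> Z k (Suc x)"
    and "k \<le> n \<Longrightarrow> Z k (Suc x) \<le> Suc (Z k x)"
    and "k \<le> n \<Longrightarrow> k \<le> x \<Longrightarrow> Z k x = zeros \<epsilon> k"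
    and "s < n \<Longrightarrow> \<epsilon> s \<noteq> 0 \<Longrightarrow> Z (Suc s) = Z s"
    and "s < n \<Longrightarrow> \<epsilon> s = 0 \<Longrightarrow> Z s x \<le> Z (Suc s) x"
    and "s < n \<Longrightarrow> \<epsilon> s = 0 \<Longrightarrow> Z (Suc s) (Suc x) \<le> Suc (Z s x)"
  using assms unfolding zero_array_def by (simp_all split: if_splits)
lemma zero_array_le_arg:
  assumes "zero_array \<epsilon> n Z" "k \<le> n"
  shows "Z k x \<le> x"
proof (induction x)
  case (Suc x)
  have "Z k (Suc x) \<le> Suc (Z k x)" using assms unfolding zero_array_def by simp
  then show ?case using Suc by simp
qed (use assms in \<open>simp add: zero_array_def\<close>)

definition zeros_of_tableau ::
    "(nat \<Rightarrow> nat) \<Rightarrow> nat list \<Rightarrow> (nat \<times> nat \<Rightarrow> nat) \<Rightarrow> nat \<Rightarrow> nat \<Rightarrow> nat" where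
  "zeros_of_tableau \<epsilon> \<mu> T k x = diagonal_count (subtableau \<mu> T (zeros \<epsilon> k)) (zeros \<epsilon> k) x"

context
  fixes lam \<mu> :: "nat list" and b d n :: nat and \<epsilon> :: "nat \<Rightarrow> nat"
  assumes lam: "is_partition lam" and \<mu>: "is_partition \<mu>"
    and sub: "diagram \<mu> \<subseteq> diagram lam"
    and box: "fits_in_box (length lam) b lam"
    and d: "d = length lam" and n: "n = d + b"
    and \<epsilon>: "\<epsilon> = letter (boundary_word d b lam)"
begin

text \<open>The \<open>t\<close>-th zero of the word of \<open>lam\<close> belongs to the row \<open>d + 1 - t\<close>.\<close>
lemma zeros_eps_ge_iff:
  assumes "1 \<le> t" "t \<le> d"
  shows "t \<le> zeros \<epsilon> k \<longleftrightarrow> part lam (d + 1 - t) + t \<le> k"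
proof -
  obtain q where "t = Suc q" using assms(1) by (cases t) auto
  then show ?thesis
    using zeros_boundary_word[OF lam box[folded d], of q k] assms unfolding \<epsilon> by auto
qed

lemma zeros_eps_le: "zeros \<epsilon> k \<le> d" and zeros_eps_n: "zeros \<epsilon> n = d"
  using zeros_boundary_word_le[OF lam box[folded d]] unfolding \<epsilon> n by auto

lemma fits_mu: "fits_in_box d b \<mu>"
proof -
  have "i \<le> length lam" if "i \<in> {1..length \<mu>}" for i
  proof -
    have "\<mu> ! (i - 1) \<in> set \<mu>" using that by (intro nth_mem) auto
    then have "\<mu> ! (i - 1) \<noteq> 0" using \<mu> unfolding is_partition_def by metis
    then have "1 \<le> part \<mu> i" using that unfolding part_def by simp
    then have "(i, 1) \<in> diagram \<mu>" using that unfolding diagram_def by simp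
    then have "(i, 1) \<in> diagram lam" using sub by (rule subsetD[rotated])
    then show ?thesis unfolding diagram_def part_def by (auto split: if_splits)
  qed
  then have "length \<mu> \<le> length lam" by (cases "length \<mu>") auto
  moreover have "part \<mu> 1 \<le> part lam 1"
  proof (cases "part \<mu> 1 = 0")
    case False
    then have "(1, part \<mu> 1) \<in> diagram \<mu>" unfolding diagram_def by simp
    then have "(1, part \<mu> 1) \<in> diagram lam" using sub by (rule subsetD[rotated])
    then show ?thesis unfolding diagram_def by simp
  qed simp
  ultimately show ?thesis using box unfolding fits_in_box_def d by simp
qed

lemma diagram_mu_row: "(i, j) \<in> diagram \<mu> \<Longrightarrow> 1 \<le> i \<and> i \<le> d \<and> 1 \<le> j"
  using fits_mu unfolding diagram_def part_def fits_in_box_def by (auto split: if_splits)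

lemma zeros_mu_le_iff:
  assumes "1 \<le> i" "i \<le> d"
  shows "zeros (letter (boundary_word d b \<mu>)) x \<le> d - i \<longleftrightarrow>
    x \<le> d - i \<or> (i, x + i - d) \<in> diagram \<mu>"
  using zeros_boundary_word[OF \<mu> fits_mu, of "d - i" x] assms
  unfolding diagram_def by auto

lemma OOT_bound:
  assumes T: "T \<in> OOT lam \<mu>" and u: "(i, j) \<in> subtableau \<mu> T t" and t: "1 \<le> t" "t \<le> d"
  shows "j < part lam (d + 1 - t) + i"
proof -
  have "(i, j) \<in> diagram \<mu>" "T (i, j) \<le> t" using u unfolding subtableau_def by auto
  then have "int j - int i < int (part lam (d + 1 - T (i, j)))"
    using T unfolding OOT_def content_def d by fastforce
  also have "part lam (d + 1 - T (i, j)) \<le> part lam (d + 1 - t)"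
    using \<open>T (i, j) \<le> t\<close> t by (intro part_antimono[OF lam]) auto
  finally show ?thesis by simp
qed

text \<open>
  The condition that defines \<open>OOT\<close> keeps all zeros of the word on line \<open>k\<close> within its first \<open>k\<close>
  letters.
\<close>
lemma zero_array_of_tableau:
  assumes T: "T \<in> OOT lam \<mu>"
  shows "zero_array \<epsilon> n (zeros_of_tableau \<epsilon> \<mu> T)"
    and "zeros_of_tableau \<epsilon> \<mu> T n x = zeros (letter (boundary_word d b \<mu>)) x"
proof -
  have S: "T \<in> SSYT \<mu> d" using T unfolding OOT_def d by simp
  note props = subtableau_props[OF \<mu> S]
  have full: "zeros_of_tableau \<epsilon> \<mu> T k x = zeros \<epsilon> k" if "k \<le> x" for k x
  proof -
    define t where "t = zeros \<epsilon> k"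
    have "{i \<in> {1..t}. t - i < x \<and> (i, x + i - t) \<notin> subtableau \<mu> T t} = {1..t}"
    proof -
      have "t - i < x \<and> (i, x + i - t) \<notin> subtableau \<mu> T t" if i: "1 \<le> i" "i \<le> t" for i
      proof -
        have "t \<le> d" unfolding t_def by (rule zeros_eps_le)
        then have *: "part lam (d + 1 - t) + t \<le> k"
          using zeros_eps_ge_iff[of t k] i unfolding t_def by simp
        then have "t \<le> x" "part lam (d + 1 - t) + i \<le> x + i - t"
          using \<open>k \<le> x\<close> by simp_all
        then show ?thesis using OOT_bound[OF T, of i "x + i - t" t] i \<open>t \<le> d\<close> by fastforce
      qed
      then show ?thesis by auto
    qed
    then show ?thesis unfolding zeros_of_tableau_def diagonal_count_def t_def by simp
  qed
  show "zero_array \<epsilon> n (zeros_of_tableau \<epsilon> \<mu> T)"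
    unfolding zero_array_def
  proof (intro conjI allI impI)
    fix s
    show "if \<epsilon> s = 0 then \<forall>x. zeros_of_tableau \<epsilon> \<mu> T s x \<le> zeros_of_tableau \<epsilon> \<mu> T (Suc s) x \<and>
        zeros_of_tableau \<epsilon> \<mu> T (Suc s) (Suc x) \<le> Suc (zeros_of_tableau \<epsilon> \<mu> T s x)
      else zeros_of_tableau \<epsilon> \<mu> T (Suc s) = zeros_of_tableau \<epsilon> \<mu> T s"
      using diagonal_count_interlace[OF props(1) props(1) props(2) props(3)]
      by (simp add: zeros_of_tableau_def fun_eq_iff)
  qed (use full diagonal_count_step[OF props(1)] in \<open>simp_all add: zeros_of_tableau_def\<close>)
  show "zeros_of_tableau \<epsilon> \<mu> T n x = zeros (letter (boundary_word d b \<mu>)) x" (is "?l = ?r")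
  proof -
    have "?l \<le> d - i \<longleftrightarrow> ?r \<le> d - i" if "1 \<le> i" "i \<le> d" for i
    proof -
      have "subtableau \<mu> T d = diagram \<mu>" unfolding subtableau_def using SSYT_D(2)[OF S] by auto
      then show ?thesis
        unfolding zeros_mu_le_iff[OF that] zeros_of_tableau_def zeros_eps_n
        using diagonal_count_le_iff[OF props(1) that, of d] by simp
    qed
    moreover have "?l \<le> d" "?r \<le> d"
      using diagonal_count_le zeros_boundary_word_le(1)[OF \<mu> fits_mu]
      unfolding zeros_of_tableau_def zeros_eps_n by simp_all
    ultimately show ?thesis
      using le_by_thresholds[of ?l d ?r] le_by_thresholds[of ?r d ?l] by (simp add: order_antisym)
  qed
qed

text \<open>The first line whose word has \<open>t\<close> zeros.\<close>
definition first_line :: "nat \<Rightarrow> nat" where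
  "first_line t = (if t = 0 then 0 else part lam (d + 1 - t) + t)"

lemma first_line:
  assumes "t \<le> d"
  shows "zeros \<epsilon> (first_line t) = t" "first_line t \<le> n"
proof -
  show "first_line t \<le> n"
    using zeros_eps_ge_iff[of t n] assms zeros_eps_n unfolding first_line_def by auto
  show "zeros \<epsilon> (first_line t) = t"
  proof (cases "t = 0")
    case False
    then have "t \<le> zeros \<epsilon> (first_line t)"
      using zeros_eps_ge_iff[of t] assms unfolding first_line_def by simp
    moreover have "\<not> Suc t \<le> zeros \<epsilon> (first_line t)"
    proof
      assume *: "Suc t \<le> zeros \<epsilon> (first_line t)"
      then have "Suc t \<le> d" using zeros_eps_le order_trans by blast
      then have "part lam (d + 1 - Suc t) + Suc t \<le> first_line t"
        using zeros_eps_ge_iff[of "Suc t"] * by simp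
      moreover have "part lam (d + 1 - t) \<le> part lam (d + 1 - Suc t)"
        using \<open>Suc t \<le> d\<close> by (intro part_antimono[OF lam]) auto
      ultimately show False using False unfolding first_line_def by simp
    qed
    ultimately show ?thesis by simp
  qed (simp add: first_line_def)
qed

text \<open>The strips that end in a 0 correspond to the possible entries \<open>t\<close> of the tableau.\<close>
lemma strip_before_first_line:
  assumes "1 \<le> t" "t \<le> d" and s: "s = first_line t - 1"
  shows "Suc s = first_line t" "s < n" "\<epsilon> s = 0" "zeros \<epsilon> s = t - 1" "zeros \<epsilon> (Suc s) = t"
proof -
  show S: "Suc s = first_line t" using assms unfolding first_line_def by simp
  then show "s < n" using first_line(2)[OF assms(2)] by simp
  show z: "zeros \<epsilon> (Suc s) = t" using first_line(1)[OF assms(2)] S by simp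
  have "\<not> t \<le> zeros \<epsilon> s"
    using zeros_eps_ge_iff[OF assms(1,2), of s] assms(1) S unfolding first_line_def by simp
  then show "\<epsilon> s = 0" "zeros \<epsilon> s = t - 1"
    using z by (cases "\<epsilon> s = 0"; simp)+
qed

lemma strip_of_zero:
  assumes "s < n" "\<epsilon> s = 0"
  shows "Suc (zeros \<epsilon> s) \<le> d" "first_line (Suc (zeros \<epsilon> s)) = Suc s"
proof -
  have z: "zeros \<epsilon> (Suc s) = Suc (zeros \<epsilon> s)" using assms(2) by simp
  then show d: "Suc (zeros \<epsilon> s) \<le> d" using zeros_eps_le[of "Suc s"] by simp
  then show "first_line (Suc (zeros \<epsilon> s)) = Suc s"
    using zeros_eps_ge_iff[of "Suc (zeros \<epsilon> s)" s] zeros_eps_ge_iff[of "Suc (zeros \<epsilon> s)" "Suc s"] z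
    unfolding first_line_def by simp
qed

context
  fixes Z :: "nat \<Rightarrow> nat \<Rightarrow> nat"
  assumes Z: "zero_array \<epsilon> n Z"
    and Zn: "\<And>x. Z n x = zeros (letter (boundary_word d b \<mu>)) x"
begin

text \<open>
  Strips that end in a 1 do not change the counts. So the rows of \<open>Z\<close> are indexed by the number of
  zeros that they contain.
\<close>
lemma Z_eq_if_zeros_eq: "k \<le> k' \<Longrightarrow> k' \<le> n \<Longrightarrow> zeros \<epsilon> k = zeros \<epsilon> k' \<Longrightarrow> Z k' = Z k"
proof (induction k' rule: dec_induct)
  case (step k')
  have "zeros \<epsilon> k \<le> zeros \<epsilon> k'" "zeros \<epsilon> k' \<le> zeros \<epsilon> (Suc k')"
    using step.hyps(1) by (auto intro: zeros_mono)
  then have "zeros \<epsilon> k = zeros \<epsilon> k'" "\<epsilon> k' \<noteq> 0"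
    using step.prems by (auto split: if_splits)
  then show ?case using step zero_arrayD(5)[OF Z, of k'] by simp
qed simp

definition word_count :: "nat \<Rightarrow> nat \<Rightarrow> nat" where
  "word_count t = Z (first_line t)"

lemma Z_eq_word_count: "k \<le> n \<Longrightarrow> Z k = word_count (zeros \<epsilon> k)"
proof -
  assume k: "k \<le> n"
  let ?k = "first_line (zeros \<epsilon> k)"
  have "zeros \<epsilon> ?k = zeros \<epsilon> k" "?k \<le> n" using first_line zeros_eps_le by auto
  then show ?thesis unfolding word_count_def
    using Z_eq_if_zeros_eq[of k ?k] Z_eq_if_zeros_eq[of ?k k] k by (cases "k \<le> ?k") auto
qed

lemma word_count:
  assumes "t \<le> d"
  shows "word_count t 0 = 0" "word_count t x \<le> word_count t (Suc x)"
    "word_count t (Suc x) \<le> Suc (word_count t x)"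
    "first_line t \<le> x \<Longrightarrow> word_count t x = t"
  using zero_arrayD(1-4)[OF Z first_line(2)[OF assms]] first_line(1)[OF assms]
  unfolding word_count_def by auto

lemma word_count_mono: "t \<le> d \<Longrightarrow> x \<le> y \<Longrightarrow> word_count t x \<le> word_count t y"
  by (rule lift_Suc_mono_le[of "word_count t"]) (rule word_count(2))

lemma word_count_le: "t \<le> d \<Longrightarrow> word_count t x \<le> t"
  using word_count_mono[of t x "max x (first_line t)"] word_count(4)[of t "max x (first_line t)"]
  by simp

lemma word_count_le_arg:
  assumes "t \<le> d"
  shows "word_count t x \<le> x"
proof (induction x)
  case (Suc x)
  then show ?case using word_count(3)[OF assms, of x] by simp
qed (use word_count(1)[OF assms] in simp)

lemma word_count_interlace:
  assumes "t < d"
  shows "word_count t x \<le> word_count (Suc t) x"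
    and "word_count (Suc t) (Suc x) \<le> Suc (word_count t x)"
proof -
  define s where "s = first_line (Suc t) - 1"
  note k = strip_before_first_line[OF _ _ s_def]
  show "word_count t x \<le> word_count (Suc t) x"
    "word_count (Suc t) (Suc x) \<le> Suc (word_count t x)"
    using zero_arrayD(6,7)[OF Z, of s x] Z_eq_word_count[of s] Z_eq_word_count[of "Suc s"] k assms
    by simp_all
qed

text \<open>
  Membership of the cell \<open>(i, j)\<close> in the \<open>t\<close>-th partition, read off the word with \<open>t\<close> zeros. The
  entry of a cell is the step at which the cell enters the chain of partitions.
\<close>
definition in_chain :: "nat \<Rightarrow> nat \<Rightarrow> nat \<Rightarrow> bool" where
  "in_chain t i j \<longleftrightarrow> i \<le> t \<and> word_count t (j + t - i) \<le> t - i"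

lemma in_chain_Suc: "t < d \<Longrightarrow> in_chain t i j \<Longrightarrow> in_chain (Suc t) i j"
  using word_count_interlace(2)[of t "j + t - i"] unfolding in_chain_def
  by (auto simp: Suc_diff_le)

lemma in_chain_mono:
  assumes "t \<le> t'" "t' \<le> d" "in_chain t i j"
  shows "in_chain t' i j"
  using assms by (induction t' rule: dec_induct) (auto intro: in_chain_Suc)

lemma in_chain_d:
  assumes "1 \<le> i" "i \<le> d" "1 \<le> j"
  shows "in_chain d i j \<longleftrightarrow> (i, j) \<in> diagram \<mu>"
proof -
  have "word_count d = Z n" using Z_eq_word_count[of n] zeros_eps_n by simp
  then show ?thesis
    unfolding in_chain_def using Zn zeros_mu_le_iff[of i "j + d - i"] assms by auto
qed

definition tableau_of :: "nat \<times> nat \<Rightarrow> nat" where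
  "tableau_of = (\<lambda>(i, j). if (i, j) \<in> diagram \<mu> then LEAST t. in_chain t i j else undefined)"

lemma tableau_of_le_iff:
  assumes "(i, j) \<in> diagram \<mu>" "t \<le> d"
  shows "tableau_of (i, j) \<le> t \<longleftrightarrow> in_chain t i j"
proof -
  have d': "in_chain d i j" using in_chain_d diagram_mu_row assms(1) by blast
  have T: "tableau_of (i, j) = (LEAST t. in_chain t i j)" unfolding tableau_of_def using assms(1) by simp
  show ?thesis
  proof
    assume "tableau_of (i, j) \<le> t"
    moreover have "in_chain (tableau_of (i, j)) i j" unfolding T using d' by (rule LeastI)
    ultimately show "in_chain t i j" using in_chain_mono assms(2) by blast
  next
    assume "in_chain t i j"
    then show "tableau_of (i, j) \<le> t" unfolding T by (rule Least_le)
  qed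
qed

lemma tableau_of_le: "(i, j) \<in> diagram \<mu> \<Longrightarrow> tableau_of (i, j) \<le> d"
  using tableau_of_le_iff[of i j d] in_chain_d diagram_mu_row by blast

lemma tableau_of_in_chain: "(i, j) \<in> diagram \<mu> \<Longrightarrow> in_chain (tableau_of (i, j)) i j"
  using tableau_of_le_iff[of i j "tableau_of (i, j)"] tableau_of_le by blast

lemma tableau_of_OOT: "tableau_of \<in> OOT lam \<mu>"
proof -
  have range: "1 \<le> tableau_of (i, j)" if "(i, j) \<in> diagram \<mu>" for i j
    using tableau_of_in_chain[OF that] diagram_mu_row[OF that] unfolding in_chain_def by linarith
  have row: "tableau_of (i, j) \<le> tableau_of (i, j + 1)"
    if "(i, j) \<in> diagram \<mu>" "(i, j + 1) \<in> diagram \<mu>" for i j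
  proof -
    let ?t = "tableau_of (i, j + 1)"
    have t: "?t \<le> d" using tableau_of_le that(2) by blast
    have "in_chain ?t i (j + 1)" using tableau_of_in_chain that(2) by blast
    then have "in_chain ?t i j"
      using word_count_mono[OF t, of "j + ?t - i" "j + 1 + ?t - i"] unfolding in_chain_def
      by (meson add_le_mono1 diff_le_mono le_add1 order_trans)
    then show ?thesis using tableau_of_le_iff[OF that(1) t] by blast
  qed
  have col: "tableau_of (i, j) < tableau_of (i + 1, j)"
    if "(i, j) \<in> diagram \<mu>" "(i + 1, j) \<in> diagram \<mu>" for i j
  proof -
    have c: "in_chain (tableau_of (i + 1, j)) (i + 1) j" using tableau_of_in_chain that(2) by blast
    then obtain t where t: "tableau_of (i + 1, j) = Suc t" "i \<le> t"
      unfolding in_chain_def by (cases "tableau_of (i + 1, j)") auto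
    have d: "Suc t \<le> d" using tableau_of_le[OF that(2)] t by simp
    have "in_chain t i j"
      using c word_count_interlace(1)[of t "j + t - i"] t(2) d unfolding in_chain_def t(1) by auto
    then show ?thesis using tableau_of_le_iff[OF that(1), of t] d t(1) by simp
  qed
  have "tableau_of \<in> SSYT \<mu> (length lam)"
    unfolding SSYT_def
  proof (intro CollectI conjI allI impI)
    show "tableau_of \<in> diagram \<mu> \<rightarrow>\<^sub>E {1..length lam}"
    proof (rule PiE_I)
      fix u assume "u \<in> diagram \<mu>"
      then show "tableau_of u \<in> {1..length lam}"
        using range tableau_of_le unfolding d by (cases u) auto
    next
      fix u assume "u \<notin> diagram \<mu>"
      then show "tableau_of u = undefined" unfolding tableau_of_def by (cases u) simp
    qed
  qed (use row col in auto)
  moreover have "content u < int (part lam (length lam + 1 - tableau_of u))"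
    if u: "u \<in> diagram \<mu>" for u
  proof -
    obtain i j where ij: "u = (i, j)" by (cases u)
    define t where "t = tableau_of u"
    have t: "1 \<le> t" "t \<le> d" "in_chain t i j" "1 \<le> i"
      using range tableau_of_le tableau_of_in_chain diagram_mu_row u unfolding t_def ij by blast+
    have "\<not> first_line t \<le> j + t - i"
      using word_count(4)[of t "j + t - i"] t unfolding in_chain_def by auto
    then have "content u < int (part lam (d + 1 - t))"
      using t unfolding first_line_def content_def ij in_chain_def by auto
    then show ?thesis unfolding t_def d .
  qed
  ultimately show ?thesis unfolding OOT_def by simp
qed

lemma zeros_of_tableau_of:
  assumes "k \<le> n"
  shows "zeros_of_tableau \<epsilon> \<mu> tableau_of k = Z k"
proof
  fix x
  define t where "t = zeros \<epsilon> k"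
  have t: "t \<le> d" unfolding t_def by (rule zeros_eps_le)
  have *: "t - i < x \<and> (i, x + i - t) \<notin> subtableau \<mu> tableau_of t \<longleftrightarrow> t - i < word_count t x"
    if i: "1 \<le> i" "i \<le> t" for i
  proof (cases "x \<le> t - i")
    case True
    then show ?thesis using word_count_le_arg[OF t, of x] by simp
  next
    case False
    define j where "j = x + i - t"
    have j: "1 \<le> j" "x = j + t - i" using False i unfolding j_def by auto
    have "(i, j) \<in> subtableau \<mu> tableau_of t \<longleftrightarrow> in_chain t i j"
      using tableau_of_le_iff[of i j t] in_chain_mono[of t d i j] in_chain_d[of i j] t i j(1)
      unfolding subtableau_def by auto
    also have "\<dots> \<longleftrightarrow> word_count t x \<le> t - i" unfolding in_chain_def j(2) using i by simp
    finally show ?thesis using False unfolding j_def by auto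
  qed
  have "zeros_of_tableau \<epsilon> \<mu> tableau_of k x = card {i \<in> {1..t}. t - i < word_count t x}"
    unfolding zeros_of_tableau_def diagonal_count_def t_def [symmetric]
    using * by (intro arg_cong[of _ _ card]) auto
  also have "{i \<in> {1..t}. t - i < word_count t x} = {t + 1 - word_count t x..t}"
    using word_count_le[OF t, of x] by auto
  also have "card \<dots> = word_count t x" using word_count_le[OF t, of x] by simp
  also have "\<dots> = Z k x" using Z_eq_word_count[OF assms] unfolding t_def by simp
  finally show "zeros_of_tableau \<epsilon> \<mu> tableau_of k x = Z k x" .
qed

end

lemma tableau_exists:
  assumes "zero_array \<epsilon> n Z" "\<And>x. Z n x = zeros (letter (boundary_word d b \<mu>)) x"
  obtains T where "T \<in> OOT lam \<mu>" "\<And>k. k \<le> n \<Longrightarrow> zeros_of_tableau \<epsilon> \<mu> T k = Z k"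
  using tableau_of_OOT[OF assms] zeros_of_tableau_of[OF assms] by blast

lemma subtableau_iff:
  assumes T: "T \<in> OOT lam \<mu>" and ij: "1 \<le> i" "1 \<le> j" "i \<le> t" and t: "t \<le> d"
  shows "(i, j) \<in> subtableau \<mu> T t \<longleftrightarrow> zeros_of_tableau \<epsilon> \<mu> T (first_line t) (j + t - i) \<le> t - i"
proof -
  have S: "T \<in> SSYT \<mu> d" using T unfolding OOT_def d by simp
  show ?thesis
    using diagonal_count_le_iff[OF subtableau_props(1)[OF \<mu> S] ij(1,3), of t "j + t - i"] ij
      first_line(1)[OF t] unfolding zeros_of_tableau_def by auto
qed

lemma tableau_unique:
  assumes T: "T \<in> OOT lam \<mu>" "T' \<in> OOT lam \<mu>"
    and eq: "\<And>k. k \<le> n \<Longrightarrow> zeros_of_tableau \<epsilon> \<mu> T k = zeros_of_tableau \<epsilon> \<mu> T' k"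
  shows "T = T'"
proof
  fix u :: "nat \<times> nat"
  have S: "T \<in> SSYT \<mu> d" "T' \<in> SSYT \<mu> d" using T unfolding OOT_def d by simp_all
  show "T u = T' u"
  proof (cases "u \<in> diagram \<mu>")
    case False
    then show ?thesis using SSYT_D(5)[OF S(1)] SSYT_D(5)[OF S(2)] by simp
  next
    case True
    obtain i j where ij: "u = (i, j)" by (cases u)
    have 1: "1 \<le> i" "1 \<le> j" using diagram_mu_row True unfolding ij by auto
    have le: "T u \<le> t \<longleftrightarrow> T' u \<le> t" if "i \<le> t" "t \<le> d" for t
      using subtableau_iff[OF T(1) 1 that] subtableau_iff[OF T(2) 1 that]
        eq[OF first_line(2)[OF that(2)]] True unfolding ij subtableau_def by simp
    have "i \<le> T u" "T u \<le> d" "i \<le> T' u" "T' u \<le> d"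
      using subtableau_props(4)[OF \<mu> S(1)] subtableau_props(4)[OF \<mu> S(2)]
        SSYT_D(2)[OF S(1)] SSYT_D(2)[OF S(2)] True unfolding ij by blast+
    then show ?thesis using le[of "T u"] le[of "T' u"] by simp
  qed
qed

text \<open>
  As \<open>(i, j)\<close> is missing from the partition before, the old word has at least \<open>t - i\<close> zeros before
  position \<open>x\<close>; as it belongs to the new partition, the new word has at most \<open>t - i\<close> zeros up to
  and including position \<open>x\<close>. The new word never has fewer zeros than the old one, so the three
  counts coincide, and this is what distinguishes the equivariant pieces.
\<close>
lemma equivariant_cell_of_entry:
  assumes T: "T \<in> OOT lam \<mu>" and u: "(i, j) \<in> diagram \<mu>"
    and t: "t = T (i, j)" and s: "s = first_line t - 1" and x: "x = j + t - 1 - i"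
  shows "x < s" "s < n" "\<epsilon> s = 0" "zeros \<epsilon> s = t - 1" "1 \<le> i" "i \<le> t" "1 \<le> j"
    "int s - int x = int (part lam (d + 1 - t)) - content (i, j)"
    "zeros_of_tableau \<epsilon> \<mu> T s x = t - i"
    "zeros_of_tableau \<epsilon> \<mu> T (Suc s) x = t - i"
    "zeros_of_tableau \<epsilon> \<mu> T (Suc s) (Suc x) = t - i"
proof -
  have S: "T \<in> SSYT \<mu> d" using T unfolding OOT_def d by simp
  have td: "1 \<le> t" "t \<le> d" using SSYT_D(1,2)[OF S u] unfolding t by simp_all
  note props = subtableau_props[OF \<mu> S]
  note step = strip_before_first_line[OF td s]
  show "s < n" "\<epsilon> s = 0" "zeros \<epsilon> s = t - 1" by (rule step)+
  show i: "1 \<le> i" "1 \<le> j" using diagram_mu_row[OF u] by simp_all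
  show it: "i \<le> t" using props(4)[OF u] unfolding t .
  have in_t: "(i, j) \<in> subtableau \<mu> T t" and not_in: "(i, j) \<notin> subtableau \<mu> T (t - 1)"
    using u td unfolding subtableau_def t by auto
  have sx: "Suc x = j + t - i" "x = j + (t - 1) - i" using x i it td by simp_all
  have s_eq: "s = part lam (d + 1 - t) + (t - 1)" using s td unfolding first_line_def by simp
  show xs: "x < s" using OOT_bound[OF T in_t td] sx it s_eq by linarith
  show "int s - int x = int (part lam (d + 1 - t)) - content (i, j)"
    using sx it td i unfolding content_def s_eq by simp
  let ?D = "subtableau \<mu> T (t - 1)" and ?E = "subtableau \<mu> T t"
  have "diagonal_count ?E t (Suc x) \<le> t - i"
    using diagonal_count_le_iff[OF props(1) i(1) it, of t "Suc x"] in_t i it unfolding sx(1) by simp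
  moreover have "t - i \<le> diagonal_count ?D (t - 1) x"
  proof (cases "i = t")
    case False
    then have le: "i \<le> t - 1" using it by simp
    have "x + i - (t - 1) = j" "\<not> x \<le> t - 1 - i" using le i td unfolding sx(2) by simp_all
    then show ?thesis
      using diagonal_count_le_iff[OF props(1) i(1) le, of "t - 1" x] not_in by simp
  qed simp
  moreover have "diagonal_count ?D (t - 1) x \<le> diagonal_count ?E t x"
    using diagonal_count_interlace(1)[OF props(1) props(1) props(2) props(3), of "t - 1" "t - 1" x] td
    by simp
  moreover have "diagonal_count ?E t x \<le> diagonal_count ?E t (Suc x)"
    by (rule diagonal_count_step(1)[OF props(1)])
  ultimately have "diagonal_count ?D (t - 1) x = t - i" "diagonal_count ?E t x = t - i"
    "diagonal_count ?E t (Suc x) = t - i" by linarith+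
  then show "zeros_of_tableau \<epsilon> \<mu> T s x = t - i" "zeros_of_tableau \<epsilon> \<mu> T (Suc s) x = t - i"
    "zeros_of_tableau \<epsilon> \<mu> T (Suc s) (Suc x) = t - i"
    unfolding zeros_of_tableau_def step(4,5) by simp_all
qed

text \<open>
  Conversely the common value \<open>z\<close> of the three counts gives the row \<open>t - z\<close>, and the \<open>Suc x - z\<close> ones
  up to position \<open>x\<close> give the column.
\<close>
lemma entry_of_equivariant_cell:
  assumes T: "T \<in> OOT lam \<mu>" and s: "s < n" "\<epsilon> s = 0"
    and t: "t = Suc (zeros \<epsilon> s)" and z: "z = zeros_of_tableau \<epsilon> \<mu> T s x"
    and eq: "\<not> z < zeros_of_tableau \<epsilon> \<mu> T (Suc s) x"
      "zeros_of_tableau \<epsilon> \<mu> T (Suc s) (Suc x) = zeros_of_tableau \<epsilon> \<mu> T (Suc s) x"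
  shows "(t - z, Suc x - z) \<in> diagram \<mu>" "T (t - z, Suc x - z) = t" "z < t" "z \<le> x"
proof -
  have S: "T \<in> SSYT \<mu> d" using T unfolding OOT_def d by simp
  note props = subtableau_props[OF \<mu> S]
  define i where "i = t - z"
  let ?D = "subtableau \<mu> T (t - 1)" and ?E = "subtableau \<mu> T t"
  have zs: "zeros \<epsilon> s = t - 1" "zeros \<epsilon> (Suc s) = t" using s(2) t by simp_all
  have dc: "diagonal_count ?D (t - 1) x = z" "diagonal_count ?E t (Suc x) \<le> z"
    using eq z unfolding zeros_of_tableau_def zs by simp_all
  show zt: "z < t" using diagonal_count_le[of ?D "t - 1" x] dc(1) t by simp
  show zx: "z \<le> x" using zero_array_le_arg[OF zero_array_of_tableau(1)[OF T], of s x] s(1) z by simp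
  have i: "1 \<le> i" "i \<le> t" "t - i = z" "Suc x + i - t = Suc x - z" using zt zx unfolding i_def by simp_all
  have E: "(i, Suc x - z) \<in> ?E"
    using diagonal_count_le_iff[OF props(1) i(1,2), of t "Suc x"] dc(2) zx i(3,4) by simp
  have D: "(i, Suc x - z) \<notin> ?D"
  proof (cases "i = t")
    case True
    show ?thesis
    proof
      assume "(i, Suc x - z) \<in> ?D"
      then have "t \<le> T (i, Suc x - z)" "T (i, Suc x - z) \<le> t - 1"
        using props(4)[of i "Suc x - z"] True unfolding subtableau_def by simp_all
      then show False using zt by simp
    qed
  next
    case False
    then have le: "i \<le> t - 1" using i(2) by simp
    have "\<not> z \<le> t - 1 - i" "x + i - (t - 1) = Suc x - z"
      using le zt zx i(1,3,4) by linarith+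
    then show ?thesis
      using diagonal_count_le_iff[OF props(1) i(1) le, of "t - 1" x] dc(1) by simp
  qed
  show "(t - z, Suc x - z) \<in> diagram \<mu>" "T (t - z, Suc x - z) = t"
    using E D unfolding i_def [symmetric] subtableau_def by auto
qed

end

section \<open>Labelings as arrays of zero counts\<close>

text \<open>
  In a strip that ends in a 0, the edges across it have label 0 or 2, and 2 means that the new word
  has met a zero that the old word is still to meet.
\<close>
definition rise_label :: "(nat \<Rightarrow> nat) \<Rightarrow> (nat \<Rightarrow> nat \<Rightarrow> nat) \<Rightarrow> nat \<Rightarrow> nat \<Rightarrow> nat" where
  "rise_label \<epsilon> Z x y = (if \<epsilon> (x + y) \<noteq> 0 then 1
     else if Z (x + y) x < Z (Suc (x + y)) x then 2 else 0)"

definition fall_label :: "(nat \<Rightarrow> nat \<Rightarrow> nat) \<Rightarrow> nat \<Rightarrow> nat \<Rightarrow> nat" where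
  "fall_label Z x y = (if Z (Suc (x + y)) (Suc x) = Z (Suc (x + y)) x then 1 else 0)"

text \<open>Two labels of an admissible triple determine the third one.\<close>
definition hor_label :: "nat \<Rightarrow> nat \<Rightarrow> nat" where
  "hor_label a b = (THE h. admissible a b h)"

lemma hor_label_eq: "admissible a b h \<Longrightarrow> hor_label a b = h"
  unfolding hor_label_def by (rule the_equality) (auto simp: admissible_def)

definition labeling :: "(nat \<Rightarrow> nat) \<Rightarrow> (nat \<Rightarrow> nat \<Rightarrow> nat) \<Rightarrow> edge \<Rightarrow> nat" where
  "labeling \<epsilon> Z e = (THE l. \<exists>x y.
     e = rise x y \<and> l = rise_label \<epsilon> Z (nat x) (nat y) \<or>
     e = fall x y \<and> l = fall_label Z (nat x) (nat y) \<or>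
     e = hor x y \<and>
       l = hor_label (rise_label \<epsilon> Z (nat x) (nat y)) (fall_label Z (nat x) (nat y)))"

lemma labeling_simps [simp]:
  "labeling \<epsilon> Z (rise x y) = rise_label \<epsilon> Z (nat x) (nat y)"
  "labeling \<epsilon> Z (fall x y) = fall_label Z (nat x) (nat y)"
  "labeling \<epsilon> Z (hor x y) =
     hor_label (rise_label \<epsilon> Z (nat x) (nat y)) (fall_label Z (nat x) (nat y))"
  unfolding labeling_def by simp_all

lemma up_cell_nat:
  assumes "up x y \<in> cells_of_triangle n"
  obtains i j where "x = int i" "y = int j" "i + j < n"
  using assms that[of "nat x" "nat y"] unfolding up_in_triangle by auto

lemma down_cell_nat:
  assumes "down x y \<in> cells_of_triangle n"
  obtains i j where "x = int i" "y = int (Suc j)" "Suc (i + j) < n"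
  using assms that[of "nat x" "nat y - 1"] unfolding down_in_triangle by auto

context
  fixes \<epsilon> :: "nat \<Rightarrow> nat" and n :: nat and Z :: "nat \<Rightarrow> nat \<Rightarrow> nat"
  assumes Z: "zero_array \<epsilon> n Z" and \<epsilon>: "\<And>s. \<epsilon> s \<le> 1"
begin

lemmas Z_0 = zero_arrayD(1)[OF Z]
  and Z_full = zero_arrayD(4)[OF Z]
  and Z_one = zero_arrayD(5)[OF Z]
  and Z_zero = zero_arrayD(6,7)[OF Z]

lemma Z_step: "k \<le> n \<Longrightarrow> Z k (Suc x) = Z k x \<or> Z k (Suc x) = Suc (Z k x)"
  using zero_arrayD(2,3)[OF Z, of k x] by linarith

lemma admissible_labels_up:
  assumes "x + y < n"
  shows "\<exists>h. admissible (rise_label \<epsilon> Z x y) (fall_label Z x y) h"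
proof (cases "\<epsilon> (x + y) = 0")
  case True
  then show ?thesis
    using Z_zero[OF assms True, of x] Z_step[of "Suc (x + y)" x] assms
    unfolding rise_label_def fall_label_def admissible_def by auto
next
  case False
  then show ?thesis unfolding rise_label_def fall_label_def admissible_def by auto
qed

text \<open>
  All cases reduce to linear inequalities between the four counts of the old and the new word at \<open>x\<close>
  and \<open>x + 1\<close>.
\<close>
lemma admissible_labels_down:
  assumes xy: "Suc (x + y) < n"
  shows "admissible (rise_label \<epsilon> Z (Suc x) y) (fall_label Z x y)
    (hor_label (rise_label \<epsilon> Z x (Suc y)) (fall_label Z x (Suc y)))"
proof -
  define s where "s = Suc (x + y)"
  have s: "s < n" using xy unfolding s_def .
  obtain h where h: "admissible (rise_label \<epsilon> Z x (Suc y)) (fall_label Z x (Suc y)) h"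
    using admissible_labels_up[of x "Suc y"] xy by auto
  have "admissible (rise_label \<epsilon> Z (Suc x) y) (fall_label Z x y) h"
  proof (cases "\<epsilon> s = 0")
    case False
    then show ?thesis
      using h Z_one[OF s False]
      unfolding rise_label_def fall_label_def admissible_def by (auto simp: s_def)
  next
    case True
    have "Suc x + y = s" "x + Suc y = s" "Suc (x + y) = s" unfolding s_def by auto
    then show ?thesis
      using h True Z_zero[OF s True, of x] Z_zero[OF s True, of "Suc x"]
        Z_step[of s x] Z_step[of "Suc s" x] s
      unfolding rise_label_def fall_label_def admissible_def by (auto split: if_splits)
  qed
  then show ?thesis using hor_label_eq[OF h] by simp
qed

lemma labeling_boundary:
  assumes "i < n"
  shows "labeling \<epsilon> Z (rise 0 (int i)) = \<epsilon> i"
    and "labeling \<epsilon> Z (hor (int i) 0) = \<epsilon> i"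
    and "labeling \<epsilon> Z (fall (int i) (int n - 1 - int i)) = (if Z n (Suc i) = Z n i then 1 else 0)"
proof -
  have e: "\<epsilon> i = 0 \<or> \<epsilon> i = 1" using \<epsilon>[of i] by linarith
  show "labeling \<epsilon> Z (rise 0 (int i)) = \<epsilon> i"
    using e Z_0[of i] Z_0[of "Suc i"] assms
    unfolding labeling_simps rise_label_def by auto
  have full: "Z i i = zeros \<epsilon> i" "Z (Suc i) (Suc i) = zeros \<epsilon> (Suc i)"
    using Z_full[of i i] Z_full[of "Suc i" "Suc i"] assms by auto
  have "admissible (rise_label \<epsilon> Z i 0) (fall_label Z i 0) (\<epsilon> i)"
    using e
  proof
    assume 0: "\<epsilon> i = 0"
    then show ?thesis
      using full Z_zero[OF assms 0, of i] Z_step[of "Suc i" i] assms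
      unfolding rise_label_def fall_label_def admissible_def by auto
  next
    assume 1: "\<epsilon> i = 1"
    then show ?thesis
      using full Z_one[OF assms]
      unfolding rise_label_def fall_label_def admissible_def by simp
  qed
  then show "labeling \<epsilon> Z (hor (int i) 0) = \<epsilon> i" using hor_label_eq by simp
  have "nat (int n - 1 - int i) = n - 1 - i" by simp
  then show "labeling \<epsilon> Z (fall (int i) (int n - 1 - int i)) = (if Z n (Suc i) = Z n i then 1 else 0)"
    using assms unfolding labeling_simps fall_label_def by (simp add: nat_int)
qed

lemma valid_labeling: "valid_labeling n (labeling \<epsilon> Z)"
  unfolding valid_labeling_def
proof (intro conjI allI impI)
  fix x y assume "up x y \<in> cells_of_triangle n"
  then show "admissible_up (labeling \<epsilon> Z) x y"
  proof (rule up_cell_nat)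
    fix i j assume *: "x = int i" "y = int j" "i + j < n"
    obtain h where "admissible (rise_label \<epsilon> Z i j) (fall_label Z i j) h"
      using admissible_labels_up[OF *(3)] by blast
    then show ?thesis unfolding admissible_up_def * using hor_label_eq by simp
  qed
next
  fix x y assume "down x y \<in> cells_of_triangle n"
  then show "admissible_down (labeling \<epsilon> Z) x y"
  proof (rule down_cell_nat)
    fix i j assume *: "x = int i" "y = int (Suc j)" "Suc (i + j) < n"
    have **: "nat (int i + 1) = Suc i" "nat (int (Suc j) - 1) = j" by auto
    show ?thesis
      unfolding admissible_down_def *(1,2) labeling_simps nat_int **
      by (rule admissible_labels_down[OF *(3)])
  qed
next
  fix i assume i: "i < n"
  show "labeling \<epsilon> Z (rise 0 (int i)) \<le> 1"
    unfolding labeling_boundary[OF i] by (rule \<epsilon>)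
  show "labeling \<epsilon> Z (hor (int i) 0) \<le> 1"
    unfolding labeling_boundary[OF i] by (rule \<epsilon>)
  show "labeling \<epsilon> Z (fall (int i) (int n - 1 - int i)) \<le> 1"
    unfolding labeling_boundary[OF i] by simp
qed

end

text \<open>
  Both sides depend only on \<open>h\<close>. So from one \<open>rise\<close> edge of a strip to the next, the surplus of labels
  2 on the farther line over those on the nearer line changes by as much as the indicator of the
  label 1 on the \<open>rise\<close> edge.
\<close>
lemma admissible_shared_hor:
  assumes "admissible a b h" "admissible a' b' h"
  shows "of_bool (b = 2) + of_bool (a = 1) = of_bool (b' = 2) + (of_bool (a' = 1) :: nat)"
proof -
  have "of_bool (b = 2) + of_bool (a = 1) = (if h = 1 \<or> h = 2 then 1 else 0 :: nat)"
    if "admissible a b h" for a b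
    using that by (cases rule: admissible_cases) simp_all
  then show ?thesis using assms by metis
qed

text \<open>
  A single strip: \<open>a\<close> and \<open>h\<close> are the labels of the edges across it, alternating as
  \<open>a 0, h 0, a 1, h 1, \<dots>, h s\<close>, while \<open>w\<close> and \<open>r\<close> are the words on the two lines that bound
  it, \<open>w\<close> on the one nearer to the origin. Both ends have the same label \<open>e\<close>.
\<close>

context
  fixes a r w h :: "nat \<Rightarrow> nat" and s e :: nat
  assumes up: "\<And>x. x \<le> s \<Longrightarrow> admissible (a x) (r x) (h x)"
    and down: "\<And>x. x < s \<Longrightarrow> admissible (a (Suc x)) (w x) (h x)"
    and ends: "a 0 = e" "h s = e" "e \<le> 1"
begin

lemma strip_twos: "(\<Sum>x<Suc s. of_bool (r x = 2)) = (\<Sum>x<s. of_bool (w x = 2) :: nat)"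
proof -
  have *: "(\<Sum>i<x. of_bool (r i = 2)) + of_bool (e = 1) =
      (\<Sum>i<x. of_bool (w i = 2)) + (of_bool (a x = 1) :: nat)" if "x \<le> s" for x
    using that
  proof (induction x)
    case (Suc x)
    then have "x \<le> s" "x < s" by auto
    have "of_bool (r x = 2) + of_bool (a x = 1) = of_bool (w x = 2) + (of_bool (a (Suc x) = 1) :: nat)"
      using up[OF \<open>x \<le> s\<close>] down[OF \<open>x < s\<close>] by (rule admissible_shared_hor)
    then show ?case using Suc by simp
  qed (use ends in simp)
  have "of_bool (r s = 2) + of_bool (a s = 1) = (of_bool (e = 1) :: nat)"
    using up[of s] ends unfolding admissible_def by auto
  then show ?thesis using *[of s] by simp
qed

lemma strip_one:
  assumes "e = 1" "\<And>x. x < s \<Longrightarrow> w x \<noteq> 2" "x \<le> s"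
  shows "a x = 1" "x < s \<Longrightarrow> r x = w x" "r s = 1"
proof -
  have step: "a (Suc x) = 1 \<and> r x = w x" if "x < s" "a x = 1" for x
    using up[of x] down[OF that(1)] assms(2)[OF that(1)] that unfolding admissible_def by auto
  have a: "a x = 1" if "x \<le> s" for x
    using that by (induction x) (use step ends assms(1) in auto)
  then show "a x = 1" using assms(3) by simp
  show "x < s \<Longrightarrow> r x = w x" using step a by simp
  show "r s = 1" using up[of s] a[of s] ends assms(1) unfolding admissible_def by auto
qed

text \<open>
  Where the label is 2, the new word is one zero ahead. It cannot get two zeros ahead because
  a \<open>rise\<close> edge with label 2 forces the letter 1.
\<close>
lemma strip_zero:
  assumes "e = 0" "\<And>x. x \<le> s \<Longrightarrow> r x \<noteq> 2" "\<And>x. x < s \<Longrightarrow> w x \<noteq> 2"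
  shows "x \<le> s \<Longrightarrow> a x \<noteq> 1 \<and> zeros r x = zeros w x + of_bool (a x = 2)"
    and "x \<le> s \<Longrightarrow> zeros r (Suc x) \<le> Suc (zeros w x)"
    and "zeros r (Suc s) = Suc (zeros w s)"
proof -
  have main: "a x \<noteq> 1 \<and> zeros r x = zeros w x + of_bool (a x = 2)" if "x \<le> s" for x
    using that
  proof (induction x)
    case (Suc x)
    then have x: "x < s" "x \<le> s" by auto
    have "a (Suc x) \<noteq> 1 \<and>
      of_bool (r x = 0) + of_bool (a x = 2) = of_bool (w x = 0) + (of_bool (a (Suc x) = 2) :: nat)"
      using up[OF x(2)] down[OF x(1)] assms(2)[OF x(2)] assms(3)[OF x(1)] Suc.IH[OF x(2)]
      unfolding admissible_def by auto
    then show ?case using Suc.IH[OF x(2)] by simp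
  qed (use ends assms(1) in simp)
  then show "x \<le> s \<Longrightarrow> a x \<noteq> 1 \<and> zeros r x = zeros w x + of_bool (a x = 2)" .
  show "zeros r (Suc x) \<le> Suc (zeros w x)" if "x \<le> s"
    using main[OF that] up[OF that] unfolding admissible_def by auto
  show "zeros r (Suc s) = Suc (zeros w s)"
    using main[of s] up[of s] ends assms(1) unfolding admissible_def by auto
qed

end

text \<open>The word on line \<open>k\<close>, that is, on the points whose coordinates add up to \<open>k\<close>, continued by ones.\<close>
definition line_word :: "(edge \<Rightarrow> nat) \<Rightarrow> nat \<Rightarrow> nat \<Rightarrow> nat" where
  "line_word L k x = (if x < k then L (fall (int x) (int k - 1 - int x)) else 1)"

context
  fixes L n \<epsilon>
  assumes valid: "valid_labeling n L" and \<epsilon>: "\<And>s. \<epsilon> s \<le> 1"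
    and left: "\<And>s. s < n \<Longrightarrow> L (rise 0 (int s)) = \<epsilon> s"
    and bottom: "\<And>s. s < n \<Longrightarrow> L (hor (int s) 0) = \<epsilon> s"
begin

lemma strip_up:
  assumes "s < n" "x \<le> s"
  shows "admissible (L (rise (int x) (int s - int x))) (line_word L (Suc s) x)
    (L (hor (int x) (int s - int x)))"
  using valid_labelingD(1)[OF valid, of "int x" "int s - int x"] assms
  unfolding up_in_triangle admissible_up_def line_word_def by simp

lemma strip_down:
  assumes "s < n" "x < s"
  shows "admissible (L (rise (int (Suc x)) (int s - int (Suc x)))) (line_word L s x)
    (L (hor (int x) (int s - int x)))"
proof -
  have "admissible_down L (int x) (int s - int x)"
    using valid_labelingD(2)[OF valid, of "int x" "int s - int x"] assms
    unfolding down_in_triangle by simp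
  moreover have "int x + 1 = int (Suc x)" "int s - int x - 1 = int s - int (Suc x)"
    "int s - 1 - int x = int s - int (Suc x)" by simp_all
  ultimately show ?thesis using assms unfolding admissible_down_def line_word_def by metis
qed

lemma strip_ends:
  assumes "s < n"
  shows "L (rise (int 0) (int s - int 0)) = \<epsilon> s" "L (hor (int s) (int s - int s)) = \<epsilon> s"
  using left[OF assms] bottom[OF assms] by simp_all

lemmas strip = strip_up strip_down strip_ends \<epsilon>

text \<open>The number of labels 2 does not change from line to line, and the line 0 has no edges.\<close>
lemma line_word_le:
  assumes "k \<le> n"
  shows "line_word L k x \<le> 1"
proof -
  have "(\<Sum>x<k. of_bool (line_word L k x = 2)) = (0::nat)"
    using assms
  proof (induction k)
    case (Suc s)
    have "s < n" using Suc.prems by simp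
    show ?case
      using strip_twos[where a = "\<lambda>x. L (rise (int x) (int s - int x))" and w = "line_word L s"
          and r = "line_word L (Suc s)" and h = "\<lambda>x. L (hor (int x) (int s - int x))",
          OF strip_up[OF \<open>s < n\<close>] strip_down[OF \<open>s < n\<close>] strip_ends[OF \<open>s < n\<close>] \<epsilon>]
        Suc by simp
  qed simp
  then have no2: "line_word L k x \<noteq> 2" if "x < k" using that by auto
  show ?thesis
  proof (cases "x < k")
    case True
    then obtain s where "k = Suc s" "x \<le> s" "s < n" using assms by (cases k) auto
    then show ?thesis using strip_up[of s x] no2[OF True] unfolding admissible_def by auto
  qed (simp add: line_word_def)
qed

lemma line_word_ne_2: "k \<le> n \<Longrightarrow> line_word L k x \<noteq> 2"
  using line_word_le[of k x] by auto

lemma zeros_line_word_pad: "k \<le> x \<Longrightarrow> zeros (line_word L k) x = zeros (line_word L k) k"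
  by (induction x rule: dec_induct) (simp_all add: line_word_def)

lemma line_word_one:
  assumes s: "s < n" "\<epsilon> s \<noteq> 0"
  shows "line_word L (Suc s) = line_word L s"
    and "x \<le> s \<Longrightarrow> L (rise (int x) (int s - int x)) = 1"
proof -
  have "\<epsilon> s = 1" using \<epsilon>[of s] s(2) by linarith
  note strip = strip_one[where a = "\<lambda>x. L (rise (int x) (int s - int x))" and w = "line_word L s"
    and r = "line_word L (Suc s)" and h = "\<lambda>x. L (hor (int x) (int s - int x))",
    OF strip_up[OF s(1)] strip_down[OF s(1)] strip_ends[OF s(1)] \<epsilon> \<open>\<epsilon> s = 1\<close> line_word_ne_2]
  show "line_word L (Suc s) = line_word L s"
  proof
    fix x
    consider "x < s" | "x = s" | "s < x" by linarith
    then show "line_word L (Suc s) x = line_word L s x"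
    proof cases
      case 1 then show ?thesis using strip(2)[of x] s by simp
    next
      case 2 then show ?thesis using strip(3)[of s] s by (simp add: line_word_def)
    qed (simp add: line_word_def)
  qed
  show "x \<le> s \<Longrightarrow> L (rise (int x) (int s - int x)) = 1" using strip(1)[of x] s by simp
qed

lemma line_word_zero:
  assumes s: "s < n" "\<epsilon> s = 0"
  shows "x \<le> s \<Longrightarrow> L (rise (int x) (int s - int x)) \<noteq> 1 \<and> zeros (line_word L (Suc s)) x =
      zeros (line_word L s) x + of_bool (L (rise (int x) (int s - int x)) = 2)"
    and "x \<le> s \<Longrightarrow> zeros (line_word L (Suc s)) (Suc x) \<le> Suc (zeros (line_word L s) x)"
    and "zeros (line_word L (Suc s)) (Suc s) = Suc (zeros (line_word L s) s)"
  using strip_zero[where a = "\<lambda>x. L (rise (int x) (int s - int x))" and w = "line_word L s"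
    and r = "line_word L (Suc s)" and h = "\<lambda>x. L (hor (int x) (int s - int x))",
    OF strip_up[OF s(1)] strip_down[OF s(1)] strip_ends[OF s(1)] \<epsilon> s(2) line_word_ne_2 line_word_ne_2]
    s(1) by simp_all

lemma zeros_line_word_full: "k \<le> n \<Longrightarrow> zeros (line_word L k) k = zeros \<epsilon> k"
proof (induction k)
  case (Suc s)
  show ?case
  proof (cases "\<epsilon> s = 0")
    case True
    then show ?thesis using line_word_zero(3)[of s] Suc by simp
  next
    case False
    then show ?thesis
      using line_word_one(1)[of s] Suc zeros_line_word_pad[of s "Suc s"] by (simp del: zeros_Suc add: zeros_Suc[of \<epsilon>])
  qed
qed simp

lemma zero_array_line_words: "zero_array \<epsilon> n (\<lambda>k. zeros (line_word L k))"
  unfolding zero_array_def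
proof (intro conjI allI impI)
  fix s assume s: "s < n"
  show "if \<epsilon> s = 0 then \<forall>x. zeros (line_word L s) x \<le> zeros (line_word L (Suc s)) x \<and>
      zeros (line_word L (Suc s)) (Suc x) \<le> Suc (zeros (line_word L s) x)
    else zeros (line_word L (Suc s)) = zeros (line_word L s)"
  proof (cases "\<epsilon> s = 0")
    case True
    have "zeros (line_word L s) x \<le> zeros (line_word L (Suc s)) x \<and>
      zeros (line_word L (Suc s)) (Suc x) \<le> Suc (zeros (line_word L s) x)" for x
    proof (cases "x \<le> s")
      case le: True
      show ?thesis using line_word_zero(1,2)[OF s True le] by simp
    next
      case False
      then have "Suc s \<le> x" by simp
      then show ?thesis
        using zeros_line_word_pad[of s x] zeros_line_word_pad[of "Suc s" x]
          zeros_line_word_pad[of "Suc s" "Suc x"] line_word_zero(3)[OF s True]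
        by (simp del: zeros_Suc)
    qed
    then show ?thesis using True by simp
  next
    case False
    then show ?thesis using line_word_one(1)[OF s] by simp
  qed
next
  fix k x assume "k \<le> n" "k \<le> x"
  then show "zeros (line_word L k) x = zeros \<epsilon> k"
    using zeros_line_word_pad zeros_line_word_full by metis
qed simp_all

text \<open>The words determine all labels, so that a valid labeling is determined by its zero counts.\<close>
lemma labeling_of_line_words:
  assumes "up x y \<in> cells_of_triangle n"
  shows "labeling \<epsilon> (\<lambda>k. zeros (line_word L k)) (rise x y) = L (rise x y)" (is ?rise)
    and "labeling \<epsilon> (\<lambda>k. zeros (line_word L k)) (fall x y) = L (fall x y)" (is ?fall)
    and "labeling \<epsilon> (\<lambda>k. zeros (line_word L k)) (hor x y) = L (hor x y)"
proof -
  obtain i j where ij: "x = int i" "y = int j" "i + j < n" using assms by (rule up_cell_nat)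
  have w: "line_word L (Suc (i + j)) i = L (fall x y)"
    unfolding line_word_def ij by simp
  have "L (fall x y) \<le> 1" using line_word_le[of "Suc (i + j)" i] ij(3) unfolding w by simp
  then show ?fall unfolding labeling_simps fall_label_def ij(1,2) nat_int zeros_Suc w[unfolded ij] by auto
  have adm: "admissible (L (rise x y)) (L (fall x y)) (L (hor x y))"
    using valid_labelingD(1)[OF valid assms] unfolding admissible_up_def .
  have j: "L (rise (int i) (int (i + j) - int i)) = L (rise x y)" unfolding ij by simp
  show ?rise
  proof (cases "\<epsilon> (i + j) = 0")
    case True
    have "L (rise x y) \<noteq> 1 \<and> zeros (line_word L (Suc (i + j))) i =
      zeros (line_word L (i + j)) i + of_bool (L (rise x y) = 2)"
      using line_word_zero(1)[OF ij(3) True, of i] unfolding j by simp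
    then show ?thesis
      unfolding labeling_simps rise_label_def ij(1,2) nat_int
      using adm True unfolding ij(1,2) admissible_def by auto
  next
    case False
    then have "L (rise x y) = 1"
      using line_word_one(2)[OF ij(3) False, of i] unfolding j by simp
    then show ?thesis using False unfolding labeling_simps rise_label_def ij by simp
  qed
  with \<open>?fall\<close> show "labeling \<epsilon> (\<lambda>k. zeros (line_word L k)) (hor x y) = L (hor x y)"
    using hor_label_eq[OF adm] by simp
qed

end

lemma line_words_of_labeling:
  assumes Z: "zero_array \<epsilon> n Z" and "k \<le> n"
  shows "zeros (line_word (labeling \<epsilon> Z) k) = Z k"
proof
  fix x
  show "zeros (line_word (labeling \<epsilon> Z) k) x = Z k x"
  proof (induction x)
    case 0
    show ?case using Z \<open>k \<le> n\<close> unfolding zero_array_def by simp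
  next
    case (Suc x)
    have step: "Z k (Suc x) = Z k x \<or> Z k (Suc x) = Suc (Z k x)"
      using Z \<open>k \<le> n\<close> unfolding zero_array_def by (metis le_SucE order_antisym)
    show ?case
    proof (cases "x < k")
      case True
      then have "nat (int k - 1 - int x) = k - 1 - x" "Suc (x + (k - 1 - x)) = k" by simp_all
      then show ?thesis using Suc step True by (auto simp: line_word_def fall_label_def)
    next
      case False
      then have "Z k (Suc x) = Z k x" using Z \<open>k \<le> n\<close> unfolding zero_array_def by simp
      then show ?thesis using Suc False by (simp add: line_word_def)
    qed
  qed
qed

section \<open>The bijection and the weights\<close>
lemma ht_rhombus_hor: "ht (rhombus_hor l m x y) = real_of_int y"
proof -
  have "\<Union> (fst (rhombus_hor l m x y)) = {(x, y), (x + 1, y), (x, y + 1), (x + 1, y - 1)}"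
    unfolding rhombus_hor_def up_def down_def by auto
  then show ?thesis unfolding ht_def by simp
qed

lemma rhombus_hor_inject: "rhombus_hor l m x y = rhombus_hor l m x' y' \<longleftrightarrow> x = x' \<and> y = y'"
proof
  assume "rhombus_hor l m x y = rhombus_hor l m x' y'"
  then have "up x y \<in> fst (rhombus_hor l m x' y')" by (metis fst_conv insertI1 rhombus_hor_def)
  then show "x = x' \<and> y = y'" by (simp add: rhombus_hor_def)
qed simp

lemma lozenges_puzzle_of:
  assumes valid: "valid_labeling n L"
  shows "lozenges (puzzle_of n L) =
    (\<lambda>(x, y). rhombus_hor 1 0 (int x) (int y)) ` {(x, y). x + y < n \<and> L (hor (int x) (int y)) = 3}"
proof (intro equalityI subsetI)
  fix p assume "p \<in> lozenges (puzzle_of n L)"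
  then obtain x y where p: "p \<in> puzzle_of n L" "p = rhombus_hor 1 0 x y"
    unfolding lozenges_def equivariant_pieces_eq by blast
  then have "up x y \<in> fst p" by (simp add: rhombus_hor_def)
  then have c: "up x y \<in> cells_of_triangle n" using piece_of_cell(1)[OF valid p(1)] by blast
  have "L (hor x y) = 3"
    using label_of_inner(2)[OF is_tiling_puzzle_of[OF valid], of x y]
      label_of_puzzle_of(3)[OF valid c] p by simp
  moreover obtain i j where "x = int i" "y = int j" "i + j < n" using c by (rule up_cell_nat)
  ultimately show "p \<in> (\<lambda>(x, y). rhombus_hor 1 0 (int x) (int y)) `
      {(x, y). x + y < n \<and> L (hor (int x) (int y)) = 3}"
    using p(2) by auto
next
  fix p assume "p \<in> (\<lambda>(x, y). rhombus_hor 1 0 (int x) (int y)) `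
      {(x, y). x + y < n \<and> L (hor (int x) (int y)) = 3}"
  then obtain i j where p: "p = rhombus_hor 1 0 (int i) (int j)" "i + j < n"
    "L (hor (int i) (int j)) = 3" by auto
  have "up (int i) (int j) \<in> cells_of_triangle n" using p(2) unfolding up_in_triangle by simp
  from puzzle_ofI(1)[OF this, of L] p(1,3) have "p \<in> puzzle_of n L"
    unfolding piece_at_up_def by simp
  then show "p \<in> lozenges (puzzle_of n L)"
    using p(1) unfolding lozenges_def equivariant_pieces_eq by blast
qed

lemma prod_ht_lozenges:
  assumes "valid_labeling n L"
  shows "(\<Prod>p\<in>lozenges (puzzle_of n L). ht p) =
    (\<Prod>(x, y)\<in>{(x, y). x + y < n \<and> L (hor (int x) (int y)) = 3}. real y)"
proof -
  have "inj_on (\<lambda>(x, y). rhombus_hor 1 0 (int x) (int y)) A" for A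
    by (rule inj_onI) (auto simp: rhombus_hor_inject simp del: One_nat_def)
  then show ?thesis
    unfolding lozenges_puzzle_of[OF assms]
    by (subst prod.reindex) (auto simp: ht_rhombus_hor case_prod_beta simp del: One_nat_def intro!: prod.cong)
qed

lemma KT_puzzles_iff:
  "P \<in> KT_puzzles a b \<alpha> \<beta> \<gamma> \<longleftrightarrow> is_tiling (a + b) P \<and>
     (\<forall>i<a + b. labeled_by P (rise 0 (int i)) (boundary_word a b \<alpha> ! i) \<and>
       labeled_by P (fall (int i) (int (a + b) - 1 - int i)) (boundary_word a b \<beta> ! i) \<and>
       labeled_by P (hor (int i) 0) (boundary_word a b \<gamma> ! i))"
proof -
  have f: "fall (int i) (int (a + b) - 1 - int i) =
      {(int i, int (a + b) - int i), (int i + 1, int (a + b) - int i - 1)}" for i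
    unfolding fall_def by (auto simp: algebra_simps)
  have l: "labeled_by P e l \<longleftrightarrow> (e, l) \<in> (\<Union>p\<in>P. snd p)" for e l
    unfolding labeled_by_def by blast
  show ?thesis
    unfolding KT_puzzles_def is_tiling_def f l rise_def hor_def mem_Collect_eq
      imp_conjR all_conj_distrib conj_assoc by (rule refl)
qed

text \<open>
  A factor that is negative forces another one to vanish: in each row the first factor is positive,
  as its content is at most 0 and all parts of \<open>lam\<close> are positive, and from one cell to the next the
  factor drops by at most 1 because the entries increase weakly.
\<close>
lemma OOT_eq_nonzero:
  assumes lam: "is_partition lam" and \<mu>: "is_partition \<mu>"
  shows "OOT lam \<mu> = {T \<in> SSYT \<mu> (length lam). OO_term lam \<mu> T \<noteq> 0}"
proof -
  have fin: "finite (diagram \<mu>)"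
  proof (rule finite_subset)
    show "diagram \<mu> \<subseteq> {1..length \<mu>} \<times> {1..part \<mu> 1}"
    proof clarify
      fix i j assume ij: "(i, j) \<in> diagram \<mu>"
      then have "1 \<le> i" "1 \<le> j" "j \<le> part \<mu> i" unfolding diagram_def by auto
      then show "i \<in> {1..length \<mu>} \<and> j \<in> {1..part \<mu> 1}"
        using part_antimono[OF \<mu>, of 1 i] unfolding part_def by (auto split: if_splits)
    qed
  qed simp
  have "(\<forall>u\<in>diagram \<mu>. content u < int (part lam (length lam + 1 - T u))) \<longleftrightarrow> OO_term lam \<mu> T \<noteq> 0"
    if T: "T \<in> SSYT \<mu> (length lam)" for T
  proof -
    let ?g = "\<lambda>u. int (part lam (length lam + 1 - T u)) - content u"
    have nz: "OO_term lam \<mu> T \<noteq> 0 \<longleftrightarrow> (\<forall>u\<in>diagram \<mu>. ?g u \<noteq> 0)"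
      unfolding OO_term_def using fin by simp
    have "?g (i, j) > 0" if all: "\<forall>u\<in>diagram \<mu>. ?g u \<noteq> 0" and ij: "(i, j) \<in> diagram \<mu>" for i j
    proof -
      have "1 \<le> j" using ij unfolding diagram_def by simp
      then show ?thesis using ij
      proof (induction j rule: dec_induct)
        case base
        have t: "1 \<le> T (i, 1)" "T (i, 1) \<le> length lam" using SSYT_D(1,2)[OF T base] by simp_all
        have "lam ! (length lam - T (i, 1)) \<in> set lam" using t by (intro nth_mem) simp
        then have "lam ! (length lam - T (i, 1)) \<noteq> 0"
          using lam unfolding is_partition_def by metis
        moreover have "1 \<le> length lam + 1 - T (i, 1)" "length lam + 1 - T (i, 1) \<le> length lam"
          using t by linarith+
        ultimately have "0 < part lam (length lam + 1 - T (i, 1))" unfolding part_def by simp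
        moreover have "1 \<le> i" using base unfolding diagram_def by simp
        ultimately show ?case unfolding content_def by simp
      next
        case (step j)
        have j: "(i, j) \<in> diagram \<mu>"
          using step.prems step.hyps(1) unfolding diagram_def by simp
        then have t: "T (i, j) \<le> T (i, Suc j)" "T (i, Suc j) \<le> length lam"
          using SSYT_D(2,3)[OF T] step.prems by simp_all
        have "part lam (length lam + 1 - T (i, j)) \<le> part lam (length lam + 1 - T (i, Suc j))"
          using t by (intro part_antimono[OF lam]) simp_all
        then have "?g (i, Suc j) \<ge> ?g (i, j) - 1" unfolding content_def by simp
        moreover have "?g (i, Suc j) \<noteq> 0" using all step.prems by blast
        ultimately show ?case using step.IH[OF j] by linarith
      qed
    qed
    then show ?thesis unfolding nz by fastforce
  qed
  then show ?thesis unfolding OOT_def by blast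
qed

text \<open>
  A tableau and a puzzle correspond if the words on the lines of the puzzle have the zero counts of
  the tableau.
\<close>
lemma tableaux_puzzles_bij:
  assumes lam: "is_partition lam" and \<mu>: "is_partition \<mu>"
    and sub: "diagram \<mu> \<subseteq> diagram lam"
    and box: "fits_in_box (length lam) b lam"
    and d: "d = length lam" and n: "n = d + b"
    and \<epsilon>: "\<epsilon> = letter (boundary_word d b lam)"
  defines "\<Phi> \<equiv> \<lambda>T. puzzle_of n (labeling \<epsilon> (zeros_of_tableau \<epsilon> \<mu> T))"
  shows "bij_betw \<Phi> (OOT lam \<mu>) (KT_puzzles d b lam \<mu> lam)"
    and "T \<in> OOT lam \<mu> \<Longrightarrow> real_of_int (OO_term lam \<mu> T) = (\<Prod>p\<in>lozenges (\<Phi> T). ht p)"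
proof -
  note ctx = lam \<mu> sub box d n \<epsilon>
  have fits_\<mu>: "fits_in_box d b \<mu>" by (rule fits_mu[OF ctx])
  have \<epsilon>_le: "\<epsilon> s \<le> 1" for s unfolding \<epsilon> using letter_boundary_word_le[OF lam] box d by simp
  have \<epsilon>_nth: "boundary_word d b lam ! i = \<epsilon> i" if "i < n" for i
    using that length_boundary_word[OF lam] box d unfolding \<epsilon> letter_def n by simp
  let ?v = "letter (boundary_word d b \<mu>)"
  have v_nth: "boundary_word d b \<mu> ! i = ?v i" if "i < n" for i
    using that length_boundary_word[OF \<mu> fits_\<mu>] unfolding letter_def n by simp
  have v_ge: "?v i = 1" if "n \<le> i" for i
    using that length_boundary_word[OF \<mu> fits_\<mu>] unfolding letter_def n by simp
  have v_01: "?v i = 0 \<or> ?v i = 1" for i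
    using letter_boundary_word_le[OF \<mu> fits_\<mu>, of i] by linarith
  have Z: "zero_array \<epsilon> n (zeros_of_tableau \<epsilon> \<mu> T)"
    "\<And>x. zeros_of_tableau \<epsilon> \<mu> T n x = zeros ?v x" if "T \<in> OOT lam \<mu>" for T
    using zero_array_of_tableau[OF ctx that] by auto
  have valid: "valid_labeling n (labeling \<epsilon> (zeros_of_tableau \<epsilon> \<mu> T))" if "T \<in> OOT lam \<mu>" for T
    using valid_labeling[OF Z(1)[OF that] \<epsilon>_le] .
  have maps: "\<Phi> T \<in> KT_puzzles d b lam \<mu> lam" if T: "T \<in> OOT lam \<mu>" for T
    unfolding KT_puzzles_iff n [symmetric]
  proof (intro conjI allI impI)
    show "is_tiling n (\<Phi> T)" unfolding \<Phi>_def by (rule is_tiling_puzzle_of[OF valid[OF T]])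
    fix i assume i: "i < n"
    note bd = labeling_boundary[OF Z(1)[OF T] \<epsilon>_le i]
    note lab = labeled_by_puzzle_of[OF valid[OF T]]
    have cells: "up 0 (int i) \<in> cells_of_triangle n" "up (int i) 0 \<in> cells_of_triangle n"
      "up (int i) (int n - 1 - int i) \<in> cells_of_triangle n"
      using i unfolding up_in_triangle by simp_all
    show "labeled_by (\<Phi> T) (rise 0 (int i)) (boundary_word d b lam ! i)"
      unfolding \<Phi>_def \<epsilon>_nth[OF i] using lab(1)[OF cells(1)] unfolding bd using \<epsilon>_le by simp
    show "labeled_by (\<Phi> T) (hor (int i) 0) (boundary_word d b lam ! i)"
      unfolding \<Phi>_def \<epsilon>_nth[OF i] using lab(3)[OF cells(2)] unfolding bd using \<epsilon>_le by simp
    have "(if zeros ?v (Suc i) = zeros ?v i then 1 else 0) = ?v i"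
      using v_01[of i] by auto
    then show "labeled_by (\<Phi> T) (fall (int i) (int n - 1 - int i)) (boundary_word d b \<mu> ! i)"
      unfolding \<Phi>_def v_nth[OF i] using lab(2)[OF cells(3)] unfolding bd Z(2)[OF T]
      using letter_boundary_word_le[OF \<mu> fits_\<mu>] by simp
  qed
  have inj: "T = T'" if T: "T \<in> OOT lam \<mu>" "T' \<in> OOT lam \<mu>" and eq: "\<Phi> T = \<Phi> T'" for T T'
  proof (rule tableau_unique[OF ctx T])
    fix k assume k: "k \<le> n"
    let ?L = "labeling \<epsilon> (zeros_of_tableau \<epsilon> \<mu> T)" and ?L' = "labeling \<epsilon> (zeros_of_tableau \<epsilon> \<mu> T')"
    have "?L (fall x y) = ?L' (fall x y)" if "up x y \<in> cells_of_triangle n" for x y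
      using label_of_puzzle_of(2)[OF valid[OF T(1)] that] label_of_puzzle_of(2)[OF valid[OF T(2)] that] eq
      unfolding \<Phi>_def by simp
    moreover have "up (int x) (int k - 1 - int x) \<in> cells_of_triangle n" if "x < k" for x
      using that k unfolding up_in_triangle by simp
    ultimately have "line_word ?L k x = line_word ?L' k x" for x unfolding line_word_def by presburger
    then have "line_word ?L k = line_word ?L' k" ..
    then show "zeros_of_tableau \<epsilon> \<mu> T k = zeros_of_tableau \<epsilon> \<mu> T' k"
      using line_words_of_labeling[OF Z(1)[OF T(1)] k] line_words_of_labeling[OF Z(1)[OF T(2)] k] by simp
  qed
  have surj: "\<exists>T\<in>OOT lam \<mu>. \<Phi> T = P" if P: "P \<in> KT_puzzles d b lam \<mu> lam" for P
  proof -
    have tiling: "is_tiling n P" and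
      sides: "\<And>i. i < n \<Longrightarrow> labeled_by P (rise 0 (int i)) (\<epsilon> i)"
        "\<And>i. i < n \<Longrightarrow> labeled_by P (hor (int i) 0) (\<epsilon> i)"
        "\<And>i. i < n \<Longrightarrow> labeled_by P (fall (int i) (int n - 1 - int i)) (?v i)"
      using P unfolding KT_puzzles_iff n [symmetric] by (simp_all add: \<epsilon>_nth v_nth)
    define L where "L = label_of P"
    have lab: "L e = l" if "labeled_by P e l" for e l
      using label_of_labeled[OF tiling] that unfolding labeled_by_def L_def by blast
    note bd = sides[THEN lab]
    have valid_L: "valid_labeling n L"
      unfolding valid_labeling_def L_def
      using admissible_label_of[OF tiling] bd[unfolded L_def] \<epsilon>_le
        letter_boundary_word_le[OF \<mu> fits_\<mu>] by simp
    let ?Z = "\<lambda>k. zeros (line_word L k)"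
    note L = valid_L \<epsilon>_le bd(1,2)
    have "line_word L n = ?v"
      unfolding line_word_def fun_eq_iff using bd(3) v_ge by simp
    then obtain T where T: "T \<in> OOT lam \<mu>" "\<And>k. k \<le> n \<Longrightarrow> zeros_of_tableau \<epsilon> \<mu> T k = ?Z k"
      using tableau_exists[OF ctx zero_array_line_words[OF L]] by metis
    have "\<Phi> T = puzzle_of n L"
      unfolding \<Phi>_def
    proof (rule puzzle_of_cong)
      fix x y assume c: "up x y \<in> cells_of_triangle n"
      obtain i j where ij: "x = int i" "y = int j" "i + j < n" using c by (rule up_cell_nat)
      have "zeros_of_tableau \<epsilon> \<mu> T (i + j) = ?Z (i + j)"
        "zeros_of_tableau \<epsilon> \<mu> T (Suc (i + j)) = ?Z (Suc (i + j))"
        using T(2) ij(3) by simp_all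
      then have "rise_label \<epsilon> (zeros_of_tableau \<epsilon> \<mu> T) i j = rise_label \<epsilon> ?Z i j"
        "fall_label (zeros_of_tableau \<epsilon> \<mu> T) i j = fall_label ?Z i j"
        unfolding rise_label_def fall_label_def by simp_all
      then show "labeling \<epsilon> (zeros_of_tableau \<epsilon> \<mu> T) (rise x y) = L (rise x y) \<and>
          labeling \<epsilon> (zeros_of_tableau \<epsilon> \<mu> T) (fall x y) = L (fall x y) \<and>
          labeling \<epsilon> (zeros_of_tableau \<epsilon> \<mu> T) (hor x y) = L (hor x y)"
        using labeling_of_line_words[OF L c] unfolding labeling_simps ij(1,2) nat_int by simp
    qed
    also have "\<dots> = P" unfolding L_def by (rule puzzle_of_label_of[OF tiling])
    finally show ?thesis using T(1) by blast
  qed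
  show "bij_betw \<Phi> (OOT lam \<mu>) (KT_puzzles d b lam \<mu> lam)"
    unfolding bij_betw_def
  proof
    show "inj_on \<Phi> (OOT lam \<mu>)" using inj by (rule inj_onI)
    show "\<Phi> ` OOT lam \<mu> = KT_puzzles d b lam \<mu> lam"
    proof (intro equalityI subsetI)
      fix P assume "P \<in> KT_puzzles d b lam \<mu> lam"
      then show "P \<in> \<Phi> ` OOT lam \<mu>" using surj by blast
    qed (use maps in blast)
  qed
  show "real_of_int (OO_term lam \<mu> T) = (\<Prod>p\<in>lozenges (\<Phi> T). ht p)" if T: "T \<in> OOT lam \<mu>"
  proof -
    let ?Z = "zeros_of_tableau \<epsilon> \<mu> T"
    let ?E = "{(x, y). x + y < n \<and> labeling \<epsilon> ?Z (hor (int x) (int y)) = 3}"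
    \<comment> \<open>The label 3 occurs in a single triple, so an equivariant piece is recognized by the other two labels.\<close>
    have E_iff: "(x, y) \<in> ?E \<longleftrightarrow> x + y < n \<and> \<epsilon> (x + y) = 0 \<and>
        \<not> ?Z (x + y) x < ?Z (Suc (x + y)) x \<and> ?Z (Suc (x + y)) (Suc x) = ?Z (Suc (x + y)) x" for x y
    proof -
      have "labeling \<epsilon> ?Z (hor (int x) (int y)) = 3 \<longleftrightarrow> rise_label \<epsilon> ?Z x y = 0 \<and> fall_label ?Z x y = 1"
        if xy: "x + y < n"
      proof -
        obtain h where h: "admissible (rise_label \<epsilon> ?Z x y) (fall_label ?Z x y) h"
          using admissible_labels_up[OF Z(1)[OF T] \<epsilon>_le xy] by blast
        have "fall_label ?Z x y \<noteq> 2" unfolding fall_label_def by simp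
        with h have "h = 3 \<longleftrightarrow> rise_label \<epsilon> ?Z x y = 0 \<and> fall_label ?Z x y = 1"
          unfolding admissible_def by auto
        then show ?thesis using hor_label_eq[OF h] by simp
      qed
      then show ?thesis unfolding rise_label_def fall_label_def by (auto split: if_splits)
    qed
    define strip where "strip u = first_line lam d (T u) - 1" for u
    define pos where "pos u = snd u + T u - 1 - fst u" for u
    define cell where "cell u = (pos u, strip u - pos u)" for u
    \<comment> \<open>\<open>Suc (zeros \<epsilon> (x + y))\<close> is the entry that belongs to the strip of the cell.\<close>
    define entry where "entry = (\<lambda>(x, y). (Suc (zeros \<epsilon> (x + y)) - ?Z (x + y) x, Suc x - ?Z (x + y) x))"
    have "OO_term lam \<mu> T = (\<Prod>(x, y)\<in>?E. int y)"
      unfolding OO_term_def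
    proof (rule prod.reindex_bij_witness[where i = entry and j = cell])
      fix u assume u: "u \<in> diagram \<mu>"
      obtain i j where ij: "u = (i, j)" by (cases u)
      note c = equivariant_cell_of_entry[OF ctx T u[unfolded ij] refl refl refl]
      have c: "pos u < strip u" "strip u < n" "\<epsilon> (strip u) = 0" "zeros \<epsilon> (strip u) = T u - 1"
        "1 \<le> i" "i \<le> T u" "1 \<le> j"
        "int (strip u) - int (pos u) = int (part lam (d + 1 - T u)) - content (i, j)"
        "?Z (strip u) (pos u) = T u - i" "?Z (Suc (strip u)) (pos u) = T u - i"
        "?Z (Suc (strip u)) (Suc (pos u)) = T u - i"
        using c unfolding strip_def pos_def ij by simp_all
      have sum: "pos u + (strip u - pos u) = strip u" using c(1) by simp
      have "Suc (pos u) - (T u - i) = j" "Suc (T u - 1) - (T u - i) = i"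
        using c(5-7) unfolding pos_def ij by simp_all
      then show "entry (cell u) = u" unfolding entry_def cell_def prod.case sum c(4,9) using ij by simp
      show "cell u \<in> ?E" unfolding cell_def E_iff sum c(9-11) using c(2,3) by simp
      have "int (strip u - pos u) = int (strip u) - int (pos u)" using c(1) by simp
      then show "(case cell u of (x, y) \<Rightarrow> int y) = int (part lam (length lam + 1 - T u)) - content u"
        unfolding cell_def prod.case using c(8) ij d by simp
    next
      fix v assume v: "v \<in> ?E"
      obtain x y where xy: "v = (x, y)" by (cases v)
      have E: "x + y < n" "\<epsilon> (x + y) = 0" "\<not> ?Z (x + y) x < ?Z (Suc (x + y)) x"
        "?Z (Suc (x + y)) (Suc x) = ?Z (Suc (x + y)) x"
        using v unfolding xy E_iff by simp_all
      let ?t = "Suc (zeros \<epsilon> (x + y))" and ?z = "?Z (x + y) x"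
      note e = entry_of_equivariant_cell[OF ctx T E(1,2) refl refl E(3,4)]
      have entry: "entry v = (?t - ?z, Suc x - ?z)" unfolding entry_def xy by simp
      show "entry v \<in> diagram \<mu>" unfolding entry by (rule e(1))
      have "T (entry v) = ?t" unfolding entry by (rule e(2))
      moreover have "first_line lam d ?t = Suc (x + y)" by (rule strip_of_zero(2)[OF ctx E(1,2)])
      ultimately have "strip (entry v) = x + y" "pos (entry v) = x"
        using e(3,4) unfolding strip_def pos_def entry by simp_all
      then show "cell (entry v) = v" unfolding cell_def xy by simp
    qed
    then show ?thesis
      unfolding \<Phi>_def prod_ht_lozenges[OF valid[OF T]] by (simp add: of_int_prod case_prod_beta)
  qed
qed

theorem theorem1p6:
  fixes lam \<mu> :: "nat list" and b :: nat
  assumes "is_partition lam" and "is_partition \<mu>"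
    and "diagram \<mu> \<subseteq> diagram lam"
    and "fits_in_box (length lam) b lam"
  shows "OOT lam \<mu> = {T \<in> SSYT \<mu> (length lam). OO_term lam \<mu> T \<noteq> 0} \<and>
    (\<exists>\<Phi>. bij_betw \<Phi> (OOT lam \<mu>) (KT_puzzles (length lam) b lam \<mu> lam) \<and>
         (\<forall>T\<in>OOT lam \<mu>. real_of_int (OO_term lam \<mu> T) = (\<Prod>p\<in>lozenges (\<Phi> T). ht p)))"
  using OOT_eq_nonzero[OF assms(1,2)] tableaux_puzzles_bij[OF assms refl refl refl] by blast

end
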